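(* Let $\Omega\subseteq\mathbb{H}^2$ be a domain and let $f:\Omega\to\mathbb{R}$ be a non constant function of class $C^2$ such that its graph $\mathcal{M}=\{(x,y,f(x,y)) : (x,y)\in\Omega\}\subset\mathbb{H}^2\times\mathbb{R}$ is a minimal surface. Then the level curves of $f$ are pre-geodesics of $\mathbb{H}^2$ if and only if $f$ is harmonic with respect to the flat Laplacian, i.e. $f_{xx}+f_{yy}=0$ on $\Omega$.
   Context: $\mathbb{H}^2$ is the upper half-plane $\{(x,y)\in\mathbb{R}^2 : y>0\}$ with the hyperbolic metric $(dx^2+dy^2)/y^2$. The product $\mathbb{H}^2\times\mathbb{R}$ carries the metric $g=\frac{dx^2+dy^2}{y^2}+dz^2$. Subscripts denote partial derivatives. The graph of $f$ is minimal if its mean curvature vanishes, which is equivalent to $$(1+y^2f_y^2)\,f_{xx}-y\,(f_x^2+f_y^2)\,f_y-2y^2\,f_x\,f_y\,f_{xy}+(1+y^2f_x^2)\,f_{yy}=0.$$ Level curves of $f$ are regular curves in $\Omega$ along which $f$ is constant. A regular curve in $\mathbb{H}^2$ is a pre-geodesic if it becomes a geodesic after reparametrization (equivalently, its geodesic curvature in $\mathbb{H}^2$ vanishes). *)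

theory Defs
  imports "HOL-Analysis.Analysis"
begin

text \<open>Everything lives in a single coordinate chart: a Riemannian metric on an open subset of
  \<^typ>\<open>real ^ 'n\<close> is given by the matrix of its coefficients at each point.\<close>

definition partial :: "'n::finite \<Rightarrow> (real ^ 'n \<Rightarrow> 'b::real_normed_vector) \<Rightarrow> real ^ 'n \<Rightarrow> 'b"
  where "partial i f p = frechet_derivative f (at p) (axis i 1)"

text \<open>Functions of class \<open>C\<^sup>k\<close>; meant for open \<open>S\<close>, since the derivative is taken at \<open>p\<close> in the
  ambient space. In finite dimensions, continuity of the derivative amounts to continuity in each
  direction.\<close>

primrec Ck_on :: "nat \<Rightarrow> 'a::euclidean_space set \<Rightarrow> ('a \<Rightarrow> 'b::real_normed_vector) \<Rightarrow> bool"
  where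
    "Ck_on 0 S f \<longleftrightarrow> continuous_on S f"
  | "Ck_on (Suc k) S f \<longleftrightarrow>
       (\<forall>p\<in>S. f differentiable (at p)) \<and>
       (\<forall>v. Ck_on k S (\<lambda>p. frechet_derivative f (at p) v))"

type_synonym 'n metric = "real ^ 'n \<Rightarrow> real ^ 'n ^ 'n"

definition metric_inner :: "'n::finite metric \<Rightarrow> real ^ 'n \<Rightarrow> real ^ 'n \<Rightarrow> real ^ 'n \<Rightarrow> real"
  where "metric_inner g p u v = (\<Sum>i\<in>UNIV. \<Sum>j\<in>UNIV. g p $ i $ j * u $ i * v $ j)"

definition christoffel :: "'n::finite metric \<Rightarrow> 'n \<Rightarrow> 'n \<Rightarrow> 'n \<Rightarrow> real ^ 'n \<Rightarrow> real"
  where "christoffel g k i j p =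
    (\<Sum>l\<in>UNIV. matrix_inv (g p) $ k $ l *
       (partial i (\<lambda>q. g q $ j $ l) p + partial j (\<lambda>q. g q $ i $ l) p
         - partial l (\<lambda>q. g q $ i $ j) p)) / 2"

text \<open>The bilinear term \<open>\<Gamma>\<^sup>k\<^sub>i\<^sub>j u\<^sup>i v\<^sup>j\<close> by which the Levi-Civita derivative differs from the
  coordinatewise one.\<close>

definition christoffel_term ::
    "'n::finite metric \<Rightarrow> real ^ 'n \<Rightarrow> real ^ 'n \<Rightarrow> real ^ 'n \<Rightarrow> real ^ 'n"
  where "christoffel_term g p u v =
    (\<chi> k. \<Sum>i\<in>UNIV. \<Sum>j\<in>UNIV. christoffel g k i j p * u $ i * v $ j)"


section \<open>Curves and geodesics\<close>

definition velocity :: "(real \<Rightarrow> 'a::real_normed_vector) \<Rightarrow> real \<Rightarrow> 'a"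
  where "velocity \<gamma> t = vector_derivative \<gamma> (at t)"

definition regular_curve :: "real set \<Rightarrow> (real \<Rightarrow> real ^ 'n::finite) \<Rightarrow> bool"
  where "regular_curve I \<gamma> \<longleftrightarrow>
    open I \<and> is_interval I \<and> I \<noteq> {} \<and> Ck_on 2 I \<gamma> \<and> (\<forall>t\<in>I. velocity \<gamma> t \<noteq> 0)"

definition geodesic :: "'n::finite metric \<Rightarrow> (real ^ 'n) set \<Rightarrow> real set \<Rightarrow> (real \<Rightarrow> real ^ 'n) \<Rightarrow> bool"
  where "geodesic g U J c \<longleftrightarrow>
    open J \<and> is_interval J \<and> J \<noteq> {} \<and> Ck_on 2 J c \<and> c ` J \<subseteq> U \<and>
    (\<forall>t\<in>J. velocity (velocity c) t + christoffel_term g (c t) (velocity c t) (velocity c t) = 0)"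

definition pregeodesic :: "'n::finite metric \<Rightarrow> (real ^ 'n) set \<Rightarrow> real set \<Rightarrow> (real \<Rightarrow> real ^ 'n) \<Rightarrow> bool"
  where "pregeodesic g U I \<gamma> \<longleftrightarrow>
    regular_curve I \<gamma> \<and>
    (\<exists>J \<phi>. open J \<and> is_interval J \<and> Ck_on 2 J \<phi> \<and> (\<forall>s\<in>J. velocity \<phi> s \<noteq> 0) \<and>
           bij_betw \<phi> J I \<and> geodesic g U J (\<gamma> \<circ> \<phi>))"

definition level_curve ::
    "(real ^ 'n::finite) set \<Rightarrow> (real ^ 'n \<Rightarrow> real) \<Rightarrow> real set \<Rightarrow> (real \<Rightarrow> real ^ 'n) \<Rightarrow> bool"
  where "level_curve \<Omega> f I \<gamma> \<longleftrightarrow>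
    regular_curve I \<gamma> \<and> \<gamma> ` I \<subseteq> \<Omega> \<and> (f \<circ> \<gamma>) constant_on I"


section \<open>Mean curvature of parametrized surfaces\<close>

definition unit_normal :: "3 metric \<Rightarrow> (real ^ 2 \<Rightarrow> real ^ 3) \<Rightarrow> real ^ 2 \<Rightarrow> real ^ 3 \<Rightarrow> bool"
  where "unit_normal g X p n \<longleftrightarrow>
    metric_inner g (X p) n n = 1 \<and> (\<forall>i. metric_inner g (X p) n (partial i X p) = 0)"

definition first_form :: "3 metric \<Rightarrow> (real ^ 2 \<Rightarrow> real ^ 3) \<Rightarrow> real ^ 2 \<Rightarrow> 2 \<Rightarrow> 2 \<Rightarrow> real"
  where "first_form g X p i j = metric_inner g (X p) (partial i X p) (partial j X p)"

definition second_form ::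
    "3 metric \<Rightarrow> (real ^ 2 \<Rightarrow> real ^ 3) \<Rightarrow> real ^ 3 \<Rightarrow> real ^ 2 \<Rightarrow> 2 \<Rightarrow> 2 \<Rightarrow> real"
  where "second_form g X n p i j =
    metric_inner g (X p) n
      (partial i (partial j X) p + christoffel_term g (X p) (partial i X p) (partial j X p))"

text \<open>Half the trace of the second fundamental form with respect to the first.\<close>

definition mean_curvature ::
    "3 metric \<Rightarrow> (real ^ 2 \<Rightarrow> real ^ 3) \<Rightarrow> real ^ 3 \<Rightarrow> real ^ 2 \<Rightarrow> real"
  where "mean_curvature g X n p =
    (let I = first_form g X p; II = second_form g X n p in
      (II 1 1 * I 2 2 - 2 * II 1 2 * I 1 2 + II 2 2 * I 1 1) / (2 * (I 1 1 * I 2 2 - (I 1 2)\<^sup>2)))"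

text \<open>Quantifying over both unit normals avoids choosing one; reversing the normal only changes
  the sign of the mean curvature.\<close>

definition minimal_surface :: "3 metric \<Rightarrow> (real ^ 2) set \<Rightarrow> (real ^ 2 \<Rightarrow> real ^ 3) \<Rightarrow> bool"
  where "minimal_surface g \<Omega> X \<longleftrightarrow>
    (\<forall>p\<in>\<Omega>. \<forall>n. unit_normal g X p n \<longrightarrow> mean_curvature g X n p = 0)"


section \<open>The hyperbolic plane and its product with the line\<close>

definition H2 :: "(real ^ 2) set"
  where "H2 = {p. p $ 2 > 0}"

definition H2_metric :: "2 metric"
  where "H2_metric p = (\<chi> i j. if i = j then 1 / (p $ 2)\<^sup>2 else 0)"

definition H2xR_metric :: "3 metric"
  where "H2xR_metric p =
    (\<chi> i j. if i \<noteq> j then 0 else if i = 3 then 1 else 1 / (p $ 2)\<^sup>2)"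

definition graph_map :: "(real ^ 2 \<Rightarrow> real) \<Rightarrow> real ^ 2 \<Rightarrow> real ^ 3"
  where "graph_map f p = vector [p $ 1, p $ 2, f p]"

definition flat_laplacian :: "(real ^ 2 \<Rightarrow> real) \<Rightarrow> real ^ 2 \<Rightarrow> real"
  where "flat_laplacian f p = partial 1 (partial 1 f) p + partial 2 (partial 2 f) p"

end

theory Submission
  imports Defs "HOL-Complex_Analysis.Conformal_Mappings"
begin

text \<open>Multiplied by suitable positive factors, the minimal surface equation of the graph reads
  \<open>f\<^sub>x\<^sub>x + f\<^sub>y\<^sub>y + y\<^sup>2 K = 0\<close>, where
  \<open>K = f\<^sub>y\<^sup>2 f\<^sub>x\<^sub>x - 2 f\<^sub>x f\<^sub>y f\<^sub>x\<^sub>y + f\<^sub>x\<^sup>2 f\<^sub>y\<^sub>y - f\<^sub>y (f\<^sub>x\<^sup>2 + f\<^sub>y\<^sup>2) / y\<close>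
  is, at a regular point of \<open>f\<close>, a positive multiple of the geodesic curvature of the level curve.
  So harmonicity amounts to \<open>K = 0\<close>, and at critical points \<open>K = 0\<close> holds trivially. If the level
  curves are pre-geodesics, apply this to the level curve through each regular point, which the
  inverse function theorem provides. Conversely, a level curve may pass through critical points of a
  harmonic \<open>f\<close>; these are isolated as zeros of the holomorphic function \<open>f\<^sub>x - \<i> f\<^sub>y\<close>, so by
  continuity the covariant acceleration is parallel to the velocity along the whole curve, and
  parametrizing by arc length turns it into a geodesic.\<close>

section \<open>The minimal surface equation of a graph\<close>

lemma partial_eq:
  assumes "(f has_derivative f') (at p)"
  shows "partial i f p = f' (axis i 1)"
  using frechet_derivative_at[OF assms] by (simp add: partial_def)

lemma has_derivative_partials:
  fixes f :: "real ^ 2 \<Rightarrow> 'b::real_normed_vector"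
  assumes "f differentiable (at p)"
  shows "(f has_derivative (\<lambda>h. h $ 1 *\<^sub>R partial 1 f p + h $ 2 *\<^sub>R partial 2 f p)) (at p)"
proof -
  let ?D = "frechet_derivative f (at p)"
  have D: "(f has_derivative ?D) (at p)"
    using assms by (simp add: frechet_derivative_works)
  have "?D h = h $ 1 *\<^sub>R partial 1 f p + h $ 2 *\<^sub>R partial 2 f p" for h
  proof -
    have "?D h = ?D (h $ 1 *\<^sub>R axis 1 1 + h $ 2 *\<^sub>R axis 2 1)"
      by (rule arg_cong[where f = ?D]) (simp add: vec_eq_iff forall_2 axis_def)
    also have "\<dots> = h $ 1 *\<^sub>R partial 1 f p + h $ 2 *\<^sub>R partial 2 f p"
      using has_derivative_linear[OF D] by (simp add: linear_add linear_cmul partial_def)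
    finally show ?thesis .
  qed
  then have "?D = (\<lambda>h. h $ 1 *\<^sub>R partial 1 f p + h $ 2 *\<^sub>R partial 2 f p)"
    by blast
  then show ?thesis using D by simp
qed

text \<open>\<open>frechet_derivative\<close> chooses among all derivatives at a point. Functions
  that agree near \<open>p\<close> have the same candidates there, so the choices coincide even
  where neither function is differentiable.\<close>

lemma partial_cong_open:
  assumes "open S" "p \<in> S" "\<And>q. q \<in> S \<Longrightarrow> f q = g q"
  shows "partial i f p = partial i g p"
proof -
  have "(f has_derivative D) (at p) \<longleftrightarrow> (g has_derivative D) (at p)" for D
    using has_derivative_transform_within_open[of f D p UNIV S g]
      has_derivative_transform_within_open[of g D p UNIV S f] assms by auto
  then show ?thesis by (simp add: partial_def frechet_derivative_def)
qed

section \<open>Inverse metrics and Christoffel terms of the half-plane and of its product with the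
  line\<close>

lemma matrix_inv_unique:
  fixes A B :: "'a::semiring_1 ^ 'n::finite ^ 'n"
  assumes "A ** B = mat 1" "B ** A = mat 1"
  shows "matrix_inv A = B"
proof -
  \<comment> \<open>\<open>matrix_inv\<close> is defined by choice; the witness \<open>B\<close>
    guarantees that the chosen matrix is a two-sided inverse.\<close>
  have "A ** matrix_inv A = mat 1 \<and> matrix_inv A ** A = mat 1"
    unfolding matrix_inv_def by (rule someI[of _ B]) (use assms in blast)
  then have "matrix_inv A = matrix_inv A ** (A ** B)"
    using assms by simp
  also have "\<dots> = B"
    using \<open>A ** matrix_inv A = mat 1 \<and> _\<close> by (simp add: matrix_mul_assoc)
  finally show ?thesis .
qed

lemma matrix_inv_H2xR_metric:
  assumes "p $ 2 > 0"
  shows "matrix_inv (H2xR_metric p) = (\<chi> i j. if i \<noteq> j then 0 else if i = 3 then 1 else (p $ 2)\<^sup>2)"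
  using assms
  by (intro matrix_inv_unique)
    (simp_all add: vec_eq_iff forall_3 matrix_matrix_mult_def sum_3 H2xR_metric_def mat_def)

lemma matrix_inv_H2_metric:
  assumes "p $ 2 > 0"
  shows "matrix_inv (H2_metric p) = (\<chi> i j. if i = j then (p $ 2)\<^sup>2 else 0)"
  using assms
  by (intro matrix_inv_unique)
    (simp_all add: vec_eq_iff forall_2 matrix_matrix_mult_def sum_2 H2_metric_def mat_def)

lemma has_derivative_vec_nth_at: "((\<lambda>q. q $ k) has_derivative (\<lambda>h. h $ k)) F"
  by (rule bounded_linear_imp_has_derivative[OF bounded_linear_vec_nth])

lemma partial_inverse_square_height:
  fixes p :: "real ^ 'n::finite" and k :: 'n
  assumes "p $ k > 0"
  shows "partial i (\<lambda>q. 1 / (q $ k)\<^sup>2) p = (if i = k then - 2 / (p $ k) ^ 3 else 0)"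
proof -
  have "((\<lambda>q. 1 / (q $ k)\<^sup>2) has_derivative (\<lambda>h. - 2 * h $ k / (p $ k) ^ 3)) (at p)"
    using assms
    by (auto intro!: derivative_eq_intros has_derivative_vec_nth_at
        simp: fun_eq_iff field_simps power2_eq_square power3_eq_cube)
  from partial_eq[OF this] show ?thesis by (simp add: axis_def)
qed

lemma partial_const [simp]: "partial i (\<lambda>q. c) p = 0"
  using partial_eq[OF has_derivative_const] by auto

lemma partial_H2xR_metric:
  assumes "p $ 2 > 0"
  shows "partial i (\<lambda>q. H2xR_metric q $ j $ l) p =
    (if i = 2 \<and> j = l \<and> j \<noteq> 3 then - 2 / (p $ 2) ^ 3 else 0)"
  using partial_inverse_square_height[OF assms]
  by (cases "j = l"; cases "l = 3") (simp_all add: H2xR_metric_def)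

lemma partial_H2_metric:
  assumes "p $ 2 > 0"
  shows "partial i (\<lambda>q. H2_metric q $ j $ l) p = (if i = 2 \<and> j = l then - 2 / (p $ 2) ^ 3 else 0)"
  using partial_inverse_square_height[OF assms]
  by (cases "j = l") (simp_all add: H2_metric_def)

text \<open>With y the second coordinate, the only nonzero symbols have upper index 1 and mixed
  lower indices 1, 2 (value -1/y), upper index 2 and lower indices 1, 1 (value 1/y), or all indices
  2 (value -1/y). The line factor is flat and contributes none.\<close>

lemma christoffel_term_H2xR:
  assumes "p $ 2 > 0"
  shows "christoffel_term H2xR_metric p u v =
    vector [- (u $ 1 * v $ 2 + u $ 2 * v $ 1) / p $ 2, (u $ 1 * v $ 1 - u $ 2 * v $ 2) / p $ 2, 0]"
  using assms
  by (simp add: vec_eq_iff forall_3 christoffel_term_def christoffel_def sum_3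
      matrix_inv_H2xR_metric partial_H2xR_metric vector_3 field_simps power2_eq_square power3_eq_cube)

lemma christoffel_term_H2:
  assumes "p $ 2 > 0"
  shows "christoffel_term H2_metric p u v =
    vector [- (u $ 1 * v $ 2 + u $ 2 * v $ 1) / p $ 2, (u $ 1 * v $ 1 - u $ 2 * v $ 2) / p $ 2]"
  using assms
  by (simp add: vec_eq_iff forall_2 christoffel_term_def christoffel_def sum_2
      matrix_inv_H2_metric partial_H2_metric vector_2 field_simps power2_eq_square power3_eq_cube)

lemma metric_inner_H2xR:
  "metric_inner H2xR_metric p u v = (u $ 1 * v $ 1 + u $ 2 * v $ 2) / (p $ 2)\<^sup>2 + u $ 3 * v $ 3"
  by (simp add: metric_inner_def sum_3 H2xR_metric_def add_divide_distrib)

section \<open>Derivatives of the graph map and its mean curvature\<close>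

lemma has_derivative_vector_3:
  assumes "(f has_derivative f') F" "(g has_derivative g') F" "(h has_derivative h') F"
  shows "((\<lambda>x. vector [f x, g x, h x] :: real ^ 3) has_derivative (\<lambda>v. vector [f' v, g' v, h' v])) F"
proof -
  have v3: "vector [a, b, c] = a *\<^sub>R axis 1 1 + b *\<^sub>R axis 2 1 + c *\<^sub>R (axis 3 1 :: real ^ 3)" for a b c
    by (simp add: vec_eq_iff forall_3 axis_def)
  show ?thesis unfolding v3 by (auto intro!: derivative_eq_intros assms)
qed

lemma partial_graph_map:
  assumes "f differentiable (at p)"
  shows "partial i (graph_map f) p = vector [axis i 1 $ 1, axis i 1 $ 2, partial i f p]"
proof -
  have "(graph_map f has_derivative (\<lambda>h. vector [h $ 1, h $ 2, frechet_derivative f (at p) h])) (at p)"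
    unfolding graph_map_def[abs_def]
    using assms by (intro has_derivative_vector_3) (auto simp: frechet_derivative_works has_derivative_vec_nth_at)
  from partial_eq[OF this] show ?thesis by (simp add: partial_def)
qed

text \<open>The formula for the first partials holds on a whole neighbourhood, so it may be
  differentiated again; its first two components are constant.\<close>

lemma partial_partial_graph_map:
  assumes S: "open S" "p \<in> S" and df: "\<And>q. q \<in> S \<Longrightarrow> f differentiable (at q)"
    and d2f: "partial j f differentiable (at p)"
  shows "partial i (partial j (graph_map f)) p = vector [0, 0, partial i (partial j f) p]"
proof -
  have "partial i (partial j (graph_map f)) p =
      partial i (\<lambda>q. vector [axis j 1 $ 1, axis j 1 $ 2, partial j f q]) p"
    using S by (rule partial_cong_open) (simp add: partial_graph_map df)
  moreover have "((\<lambda>q. vector [axis j 1 $ 1, axis j 1 $ 2, partial j f q] :: real ^ 3) has_derivative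
      (\<lambda>h. vector [0, 0, frechet_derivative (partial j f) (at p) h])) (at p)"
    using d2f by (intro has_derivative_vector_3) (auto simp: frechet_derivative_works)
  ultimately show ?thesis
    using partial_eq by (fastforce simp: partial_def)
qed

text \<open>The hypothesis covers every unit normal, so it suffices to evaluate the mean curvature
  at one explicit normal and clear the positive factors.\<close>

lemma minimal_graph_equation:
  assumes S: "open \<Omega>" "p \<in> \<Omega>" and y: "p $ 2 > 0"
    and df: "\<And>q. q \<in> \<Omega> \<Longrightarrow> f differentiable (at q)"
    and d2f: "\<And>i. partial i f differentiable (at p)"
    and min: "minimal_surface H2xR_metric \<Omega> (graph_map f)"
  shows "flat_laplacian f p +
    (p $ 2)\<^sup>2 * ((partial 2 f p)\<^sup>2 * partial 1 (partial 1 f) p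
      - 2 * partial 1 f p * partial 2 f p * partial 1 (partial 2 f) p
      + (partial 1 f p)\<^sup>2 * partial 2 (partial 2 f) p
      - partial 2 f p * ((partial 1 f p)\<^sup>2 + (partial 2 f p)\<^sup>2) / p $ 2) = 0"
proof -
  define a b y where "a = partial 1 f p" and "b = partial 2 f p" and "y = p $ 2"
  define r s t where "r = partial 1 (partial 1 f) p" and "s = partial 1 (partial 2 f) p"
    and "t = partial 2 (partial 2 f) p"
  define W where "W = sqrt (1 + y\<^sup>2 * (a\<^sup>2 + b\<^sup>2))"
  have "y > 0" using \<open>p $ 2 > 0\<close> by (simp add: y_def)
  have "1 + y\<^sup>2 * (a\<^sup>2 + b\<^sup>2) > 0" by (simp add: add_pos_nonneg)
  then have W: "W > 0" "W\<^sup>2 = 1 + y\<^sup>2 * (a\<^sup>2 + b\<^sup>2)" by (simp_all add: W_def)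
  let ?X = "graph_map f"
  \<comment> \<open>The upward normal: the gradient of z - f(x,y) in the product metric is (-y^2 a,
    -y^2 b, 1), and its length is \<open>W\<close>.\<close>
  define n :: "real ^ 3" where "n = vector [- y\<^sup>2 * a / W, - y\<^sup>2 * b / W, 1 / W]"
  have X2: "?X p $ 2 = y" by (simp add: graph_map_def y_def)
  have dX: "partial 1 ?X p = vector [1, 0, a]" "partial 2 ?X p = vector [0, 1, b]"
    using df[OF S(2)] by (simp_all add: partial_graph_map a_def b_def axis_def)
  have ddX: "partial 1 (partial 1 ?X) p = vector [0, 0, r]"
    "partial 1 (partial 2 ?X) p = vector [0, 0, s]"
    "partial 2 (partial 2 ?X) p = vector [0, 0, t]"
    using partial_partial_graph_map[OF S df d2f] by (simp_all add: r_def s_def t_def)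
  have "metric_inner H2xR_metric (?X p) n n = 1"
  proof -
    have "metric_inner H2xR_metric (?X p) n n = (y\<^sup>2 * (a\<^sup>2 + b\<^sup>2) + 1) / W\<^sup>2"
      using \<open>y > 0\<close> W(1) by (simp add: metric_inner_H2xR X2 n_def field_simps power2_eq_square)
    then show ?thesis using W \<open>1 + y\<^sup>2 * (a\<^sup>2 + b\<^sup>2) > 0\<close> by (simp add: add.commute)
  qed
  moreover have "metric_inner H2xR_metric (?X p) n (partial i ?X p) = 0" for i
    using exhaust_2[of i] \<open>y > 0\<close>
    by (auto simp: metric_inner_H2xR X2 n_def dX)
  ultimately have "unit_normal H2xR_metric ?X p n" by (simp add: unit_normal_def)
  then have H: "mean_curvature H2xR_metric ?X n p = 0"
    using min S(2) by (simp add: minimal_surface_def)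
  have I: "first_form H2xR_metric ?X p 1 1 = 1 / y\<^sup>2 + a\<^sup>2"
    "first_form H2xR_metric ?X p 1 2 = a * b"
    "first_form H2xR_metric ?X p 2 2 = 1 / y\<^sup>2 + b\<^sup>2"
    by (simp_all add: first_form_def metric_inner_H2xR X2 dX power2_eq_square)
  have II: "second_form H2xR_metric ?X n p 1 1 = (r - b / y) / W"
    "second_form H2xR_metric ?X n p 1 2 = (s + a / y) / W"
    "second_form H2xR_metric ?X n p 2 2 = (t + b / y) / W"
    using \<open>y > 0\<close> W(1)
    by (simp_all add: second_form_def metric_inner_H2xR christoffel_term_H2xR X2 dX ddX n_def
        field_simps power2_eq_square)
  \<comment> \<open>Division by zero yields 0, so the mean curvature could vanish for the wrong
    reason; positivity of the determinant of the first form excludes this and makes the numerator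
    vanish.\<close>
  have pos: "(1 / y\<^sup>2 + a\<^sup>2) * (1 / y\<^sup>2 + b\<^sup>2) - (a * b)\<^sup>2 > 0"
  proof -
    have "(1 / y\<^sup>2 + a\<^sup>2) * (1 / y\<^sup>2 + b\<^sup>2) - (a * b)\<^sup>2 = (1 / y\<^sup>2) * (1 / y\<^sup>2 + a\<^sup>2 + b\<^sup>2)"
      by (simp add: algebra_simps)
    also have "\<dots> > 0" using \<open>y > 0\<close> by (intro mult_pos_pos add_pos_nonneg) auto
    finally show ?thesis .
  qed
  let ?N = "(r - b / y) * (1 / y\<^sup>2 + b\<^sup>2) - 2 * (s + a / y) * (a * b) + (t + b / y) * (1 / y\<^sup>2 + a\<^sup>2)"
  have "P / W * A - 2 * (Q / W) * B + R / W * C = (P * A - 2 * Q * B + R * C) / W"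
    for P Q R A B C :: real
    by (simp add: diff_divide_distrib add_divide_distrib)
  then have "?N / W / (2 * ((1 / y\<^sup>2 + a\<^sup>2) * (1 / y\<^sup>2 + b\<^sup>2) - (a * b)\<^sup>2)) = 0"
    using H unfolding mean_curvature_def Let_def I II by metis
  then have E: "?N = 0"
    using pos W(1) by (metis divide_eq_0_iff less_irrefl mult_eq_0_iff zero_neq_numeral)
  \<comment> \<open>The terms b/y and -b/y from the Christoffel symbols cancel where they meet
    1/y^2; what they contribute elsewhere combines to the last term, of third order in the
    gradient.\<close>
  have "r + t + y\<^sup>2 * (b\<^sup>2 * r - 2 * a * b * s + a\<^sup>2 * t - b * (a\<^sup>2 + b\<^sup>2) / y) =
     y\<^sup>2 * ((r - b / y) * (1 / y\<^sup>2 + b\<^sup>2) - 2 * (s + a / y) * (a * b) + (t + b / y) * (1 / y\<^sup>2 + a\<^sup>2))"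
    using \<open>y > 0\<close> by (simp add: field_simps power2_eq_square)
  then show ?thesis
    unfolding E by (simp add: flat_laplacian_def a_def b_def y_def r_def s_def t_def)
qed

section \<open>Curves and their reparametrization\<close>

lemma velocity_eq: "(\<gamma> has_vector_derivative v) (at t) \<Longrightarrow> velocity \<gamma> t = v"
  by (simp add: velocity_def vector_derivative_at)

lemma has_velocity:
  "\<gamma> differentiable (at t) \<Longrightarrow> (\<gamma> has_vector_derivative velocity \<gamma> t) (at t)"
  by (simp add: velocity_def vector_derivative_works)

lemma frechet_derivative_curve:
  assumes "(\<gamma> has_vector_derivative v) (at t)"
  shows "frechet_derivative \<gamma> (at t) = (\<lambda>x. x *\<^sub>R v)"
  using assms frechet_derivative_at unfolding has_vector_derivative_def by metis

text \<open>For a curve, the direction 1 alone in \<open>Ck_on\<close> yields the velocity. The two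
  agree on the open set \<open>I\<close>, hence near each of its points, and can therefore be
  interchanged under a further derivative.\<close>

lemma Ck_on_2_curveD:
  assumes "Ck_on 2 I \<gamma>" and I: "open I"
  shows "\<And>t. t \<in> I \<Longrightarrow> (\<gamma> has_vector_derivative velocity \<gamma> t) (at t)"
    and "\<And>t. t \<in> I \<Longrightarrow> (velocity \<gamma> has_vector_derivative velocity (velocity \<gamma>) t) (at t)"
    and "continuous_on I (velocity (velocity \<gamma>))"
proof -
  have 1: "\<And>s. s \<in> I \<Longrightarrow> \<gamma> differentiable (at s)"
    and 2: "\<And>s. s \<in> I \<Longrightarrow> (\<lambda>p. frechet_derivative \<gamma> (at p) 1) differentiable (at s)"
    and 3: "continuous_on I (\<lambda>s. frechet_derivative (\<lambda>p. frechet_derivative \<gamma> (at p) 1) (at s) 1)"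
    using assms(1) by (simp_all add: numeral_2_eq_2)
  have v: "frechet_derivative \<gamma> (at s) 1 = velocity \<gamma> s" if "s \<in> I" for s
    using frechet_derivative_curve[OF has_velocity[OF 1[OF that]]] by simp
  have vd: "(velocity \<gamma> has_vector_derivative
      frechet_derivative (\<lambda>p. frechet_derivative \<gamma> (at p) 1) (at s) 1) (at s)" if "s \<in> I" for s
  proof (rule has_vector_derivative_transform_within_open[OF _ I that])
    show "((\<lambda>p. frechet_derivative \<gamma> (at p) 1) has_vector_derivative
      frechet_derivative (\<lambda>p. frechet_derivative \<gamma> (at p) 1) (at s) 1) (at s)"
      using has_velocity[OF 2[OF that]] frechet_derivative_curve[OF has_velocity[OF 2[OF that]]]
      by simp
  qed (use v in auto)
  show "(\<gamma> has_vector_derivative velocity \<gamma> t) (at t)" if "t \<in> I" for t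
    using has_velocity 1 that by blast
  show "(velocity \<gamma> has_vector_derivative velocity (velocity \<gamma>) t) (at t)" if "t \<in> I" for t
    using vd[OF that] velocity_eq by metis
  show "continuous_on I (velocity (velocity \<gamma>))"
    using continuous_on_cong[THEN iffD1, OF refl _ 3] velocity_eq[OF vd] by metis
qed

text \<open>The derivative in direction \<open>v\<close> is \<open>v\<close> times the velocity, so
  explicit first and second derivatives settle all directions in \<open>Ck_on\<close> at
  once.\<close>

lemma Ck_on_2_curveI:
  assumes I: "open I"
    and 1: "\<And>t. t \<in> I \<Longrightarrow> (\<gamma> has_vector_derivative \<gamma>' t) (at t)"
    and 2: "\<And>t. t \<in> I \<Longrightarrow> (\<gamma>' has_vector_derivative \<gamma>'' t) (at t)"
    and 3: "continuous_on I \<gamma>''"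
  shows "Ck_on 2 I \<gamma>"
    and "\<And>t. t \<in> I \<Longrightarrow> velocity \<gamma> t = \<gamma>' t"
    and "\<And>t. t \<in> I \<Longrightarrow> velocity (velocity \<gamma>) t = \<gamma>'' t"
proof -
  have fd: "frechet_derivative \<gamma> (at t) = (\<lambda>x. x *\<^sub>R \<gamma>' t)" if "t \<in> I" for t
    using frechet_derivative_curve[OF 1[OF that]] .
  have d2: "((\<lambda>p. frechet_derivative \<gamma> (at p) v) has_vector_derivative v *\<^sub>R \<gamma>'' t) (at t)"
    if "t \<in> I" for t v
  proof (rule has_vector_derivative_transform_within_open[OF _ I that])
    show "((\<lambda>p. v *\<^sub>R \<gamma>' p) has_vector_derivative v *\<^sub>R \<gamma>'' t) (at t)"
      using 2[OF that] by (auto intro!: derivative_eq_intros)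
  qed (simp add: fd)
  have "continuous_on I (\<lambda>t. frechet_derivative (\<lambda>p. frechet_derivative \<gamma> (at p) v) (at t) w)" for v w
  proof -
    have "continuous_on I (\<lambda>t. w *\<^sub>R v *\<^sub>R \<gamma>'' t)"
      using 3 by (intro continuous_intros)
    then show ?thesis
      by (rule continuous_on_cong[THEN iffD1, rotated -1])
        (simp_all add: frechet_derivative_curve[OF d2])
  qed
  moreover have "\<gamma> differentiable (at t)" if "t \<in> I" for t
    using 1[OF that] unfolding has_vector_derivative_def by (rule differentiableI)
  moreover have "(\<lambda>p. frechet_derivative \<gamma> (at p) v) differentiable (at t)" if "t \<in> I" for t v
    using d2[OF that] unfolding has_vector_derivative_def by (rule differentiableI)
  ultimately show "Ck_on 2 I \<gamma>" by (simp add: numeral_2_eq_2)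
  show v: "velocity \<gamma> t = \<gamma>' t" if "t \<in> I" for t
    using 1[OF that] by (rule velocity_eq)
  show "velocity (velocity \<gamma>) t = \<gamma>'' t" if "t \<in> I" for t
    using has_vector_derivative_transform_within_open[OF 2[OF that] I that] v
    by (auto intro!: velocity_eq)
qed

section \<open>Covariant acceleration and its change under reparametrization\<close>

definition covariant_acceleration ::
    "'n::finite metric \<Rightarrow> (real \<Rightarrow> real ^ 'n) \<Rightarrow> real \<Rightarrow> real ^ 'n"
  where "covariant_acceleration g \<gamma> t =
    velocity (velocity \<gamma>) t + christoffel_term g (\<gamma> t) (velocity \<gamma> t) (velocity \<gamma> t)"

lemma christoffel_term_scaleR:
  "christoffel_term g p (x *\<^sub>R u) (x *\<^sub>R u) = x\<^sup>2 *\<^sub>R christoffel_term g p u u"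
  by (simp add: vec_eq_iff christoffel_term_def sum_distrib_left power2_eq_square algebra_simps)

text \<open>The chain rule produces the tangential term with the second derivative of \<phi>, and
  the Christoffel term is quadratic in the velocity. Hence reparametrizing rescales the covariant
  acceleration and adds only a multiple of the velocity.\<close>

lemma reparametrized_curve:
  assumes \<gamma>: "Ck_on 2 I \<gamma>" "open I" and \<phi>: "Ck_on 2 J \<phi>" "open J" and im: "\<phi> ` J \<subseteq> I"
  shows "Ck_on 2 J (\<gamma> \<circ> \<phi>)"
    and "\<And>s. s \<in> J \<Longrightarrow> covariant_acceleration g (\<gamma> \<circ> \<phi>) s =
      (velocity \<phi> s)\<^sup>2 *\<^sub>R covariant_acceleration g \<gamma> (\<phi> s) + velocity (velocity \<phi>) s *\<^sub>R velocity \<gamma> (\<phi> s)"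
proof -
  note D = Ck_on_2_curveD[OF \<gamma>] and E = Ck_on_2_curveD[OF \<phi>]
  have I: "\<phi> s \<in> I" if "s \<in> J" for s using im that by auto
  let ?c' = "\<lambda>s. velocity \<phi> s *\<^sub>R velocity \<gamma> (\<phi> s)"
  let ?c'' = "\<lambda>s. (velocity \<phi> s)\<^sup>2 *\<^sub>R velocity (velocity \<gamma>) (\<phi> s)
    + velocity (velocity \<phi>) s *\<^sub>R velocity \<gamma> (\<phi> s)"
  have 1: "((\<gamma> \<circ> \<phi>) has_vector_derivative ?c' s) (at s)" if "s \<in> J" for s
    using vector_diff_chain_at[OF E(1)[OF that] D(1)[OF I[OF that]]] .
  have 2: "(?c' has_vector_derivative ?c'' s) (at s)" if "s \<in> J" for s
  proof -
    have "((\<lambda>s. velocity \<gamma> (\<phi> s)) has_vector_derivative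
        velocity \<phi> s *\<^sub>R velocity (velocity \<gamma>) (\<phi> s)) (at s)"
      using vector_diff_chain_at[OF E(1)[OF that] D(2)[OF I[OF that]]] by (simp add: o_def)
    moreover have "(velocity \<phi> has_field_derivative velocity (velocity \<phi>) s) (at s)"
      using E(2)[OF that] by (simp add: has_real_derivative_iff_has_vector_derivative)
    ultimately show ?thesis
      by (auto intro!: derivative_eq_intros simp: power2_eq_square)
  qed
  have c\<phi>: "continuous_on J \<phi>" "continuous_on J (velocity \<phi>)"
    using E(1,2) continuous_at_imp_continuous_on has_vector_derivative_continuous by blast+
  have c\<gamma>: "continuous_on I (velocity \<gamma>)"
    using D(2) continuous_at_imp_continuous_on has_vector_derivative_continuous by blast
  have "continuous_on J (\<lambda>s. velocity \<gamma> (\<phi> s))" "continuous_on J (\<lambda>s. velocity (velocity \<gamma>) (\<phi> s))"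
    using continuous_on_compose2[OF c\<gamma> c\<phi>(1) im] continuous_on_compose2[OF D(3) c\<phi>(1) im] .
  then have 3: "continuous_on J ?c''"
    using c\<phi>(2) E(3) by (intro continuous_intros)
  note C = Ck_on_2_curveI[of J "\<gamma> \<circ> \<phi>" ?c' ?c'', OF \<phi>(2) 1 2 3]
  show "Ck_on 2 J (\<gamma> \<circ> \<phi>)" using C(1) .
  show "covariant_acceleration g (\<gamma> \<circ> \<phi>) s =
      (velocity \<phi> s)\<^sup>2 *\<^sub>R covariant_acceleration g \<gamma> (\<phi> s) + velocity (velocity \<phi>) s *\<^sub>R velocity \<gamma> (\<phi> s)"
    if "s \<in> J" for s
    using C(2,3) that
    by (simp add: covariant_acceleration_def christoffel_term_scaleR scaleR_add_right)
qed

text \<open>Since the reparametrized curve has zero covariant acceleration, the transformation rule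
  can be solved for that of \<gamma>, dividing by the square of the nonzero velocity of
  \<phi>.\<close>

lemma pregeodesic_acceleration:
  assumes "pregeodesic g U I \<gamma>" and "t \<in> I"
  obtains l where "covariant_acceleration g \<gamma> t = l *\<^sub>R velocity \<gamma> t"
proof -
  from assms(1) obtain J \<phi> where \<phi>: "open J" "Ck_on 2 J \<phi>" "\<And>s. s \<in> J \<Longrightarrow> velocity \<phi> s \<noteq> 0"
    "bij_betw \<phi> J I" "geodesic g U J (\<gamma> \<circ> \<phi>)" and "regular_curve I \<gamma>"
    by (auto simp: pregeodesic_def)
  have \<gamma>: "Ck_on 2 I \<gamma>" "open I" using \<open>regular_curve I \<gamma>\<close> by (auto simp: regular_curve_def)
  obtain s where s: "s \<in> J" "\<phi> s = t"
    using \<phi>(4) assms(2) by (auto simp: bij_betw_def)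
  have "covariant_acceleration g (\<gamma> \<circ> \<phi>) s = 0"
    using \<phi>(5) s(1) by (auto simp: geodesic_def covariant_acceleration_def)
  then have "(velocity \<phi> s)\<^sup>2 *\<^sub>R covariant_acceleration g \<gamma> t + velocity (velocity \<phi>) s *\<^sub>R velocity \<gamma> t = 0"
    using reparametrized_curve(2)[OF \<gamma> \<phi>(2,1) _ s(1)] \<phi>(4) s(2) by (auto simp: bij_betw_def)
  then have "(velocity \<phi> s)\<^sup>2 *\<^sub>R covariant_acceleration g \<gamma> t = - velocity (velocity \<phi>) s *\<^sub>R velocity \<gamma> t"
    by (simp add: eq_neg_iff_add_eq_0)
  then have "(1 / (velocity \<phi> s)\<^sup>2) *\<^sub>R (velocity \<phi> s)\<^sup>2 *\<^sub>R covariant_acceleration g \<gamma> t =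
      (1 / (velocity \<phi> s)\<^sup>2) *\<^sub>R (- velocity (velocity \<phi>) s) *\<^sub>R velocity \<gamma> t"
    by (rule arg_cong)
  then have "covariant_acceleration g \<gamma> t = (- velocity (velocity \<phi>) s / (velocity \<phi> s)\<^sup>2) *\<^sub>R velocity \<gamma> t"
    using \<phi>(3)[OF s(1)] by simp
  then show ?thesis by (rule that)
qed

text \<open>\<phi> is the inverse of an antiderivative of \<open>w\<close>, as in the passage to arc
  length. It solves the differential equation \<phi>' = 1 / w(\<phi>), and differentiating this
  equation gives the second derivative.\<close>

lemma reparametrization_with_speed:
  fixes w w' :: "real \<Rightarrow> real"
  assumes I: "open I" "is_interval I"
    and w: "\<And>t. t \<in> I \<Longrightarrow> w t > 0" "\<And>t. t \<in> I \<Longrightarrow> (w has_field_derivative w' t) (at t)"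
    and w': "continuous_on I w'"
  obtains J \<phi> where "open J" "is_interval J" "Ck_on 2 J \<phi>" "bij_betw \<phi> J I"
    "\<And>s. s \<in> J \<Longrightarrow> velocity \<phi> s = 1 / w (\<phi> s)"
    "\<And>s. s \<in> J \<Longrightarrow> velocity (velocity \<phi>) s = - w' (\<phi> s) / w (\<phi> s) ^ 3"
proof (cases "I = {}")
  case True
  then show ?thesis by (intro that[of "{}" id]) (auto simp: numeral_2_eq_2 bij_betw_def)
next
  case False
  then obtain c where c: "c \<in> I" by auto
  have cw: "continuous_on I w"
    using w(2) by (meson DERIV_isCont continuous_at_imp_continuous_on)
  \<comment> \<open>The interval integral is signed, so one formula serves on both sides of the base
    point \<open>c\<close>.\<close>
  define \<psi> :: "real \<Rightarrow> real" where "\<psi> t = (LBINT y=c..t. w y)" for t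
  have d\<psi>: "(\<psi> has_field_derivative w t) (at t)" if "t \<in> I" for t
  proof -
    have "min c t \<in> I" "max c t \<in> I" using c that by (auto simp: min_def max_def)
    then obtain e1 e2 where "e1 > 0" "ball (min c t) e1 \<subseteq> I" "e2 > 0" "ball (max c t) e2 \<subseteq> I"
      using I(1) open_contains_ball by metis
    then obtain e where e: "e > 0" "ball (min c t) e \<subseteq> I" "ball (max c t) e \<subseteq> I"
      by (intro that[of "min e1 e2"]) (auto simp: subset_eq)
    \<comment> \<open>The fundamental theorem gives a derivative within a compact interval only.
      Widening the ends by \<open>e / 2\<close> stays inside \<open>I\<close> and makes
      \<open>t\<close> an interior point, so the derivative is two-sided.\<close>
    let ?a = "min c t - e / 2" and ?b = "max c t + e / 2"
    have "?a \<in> I" "?b \<in> I" using e by (auto simp: subset_eq dist_real_def)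
    then have "{?a..?b} \<subseteq> I" using I(2) by (meson atLeastAtMost_iff mem_is_interval_1_I subsetI)
    then have "continuous_on {?a..?b} w" using cw continuous_on_subset by blast
    moreover have "?a < c" "c < ?b" "?a < t" "t < ?b" using e(1) by (auto simp: min_def max_def)
    ultimately have "((\<lambda>u. LBINT y=c..u. w y) has_vector_derivative w t) (at t within {?a..?b})"
      by (intro interval_integral_FTC2) auto
    then show ?thesis
      unfolding \<psi>_def[abs_def] using \<open>?a < t\<close> \<open>t < ?b\<close>
      by (simp add: at_within_Icc_at has_real_derivative_iff_has_vector_derivative)
  qed
  have mono: "\<psi> s < \<psi> t" if "s \<in> I" "t \<in> I" "s < t" for s t
  proof (rule DERIV_pos_imp_increasing[OF that(3)])
    fix x assume "s \<le> x" "x \<le> t"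
    then have "x \<in> I" using I(2) that by (meson mem_is_interval_1_I)
    then show "\<exists>y. (\<psi> has_field_derivative y) (at x) \<and> 0 < y" using d\<psi> w(1) by blast
  qed
  then have inj: "inj_on \<psi> I"
    by (intro strict_mono_on_imp_inj_on strict_mono_onI)
  have c\<psi>: "continuous_on I \<psi>"
    using d\<psi> by (meson DERIV_isCont continuous_at_imp_continuous_on)
  define J where "J = \<psi> ` I"
  define \<phi> where "\<phi> = the_inv_into I \<psi>"
  have J: "open J" "is_interval J"
    using invariance_of_domain[OF c\<psi> I(1) inj] connected_continuous_image[OF c\<psi>] I(2)
    by (auto simp: J_def is_interval_connected_1)
  have bij: "bij_betw \<phi> J I"
    unfolding J_def \<phi>_def using inj by (simp add: bij_betw_the_inv_into inj_on_imp_bij_betw)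
  have \<phi>: "\<phi> s \<in> I" "\<psi> (\<phi> s) = s" if "s \<in> J" for s
    using that inj by (auto simp: J_def \<phi>_def the_inv_into_f_f)
  have d\<phi>: "(\<phi> has_field_derivative 1 / w (\<phi> s)) (at s)" if "s \<in> J" for s
  proof -
    have "(\<phi> has_field_derivative inverse (w (\<phi> s))) (at s)"
    proof (rule has_field_derivative_inverse_strong_x[where S = I and f = \<psi>])
      show "(\<psi> has_field_derivative w (\<phi> s)) (at (\<phi> s))" using d\<psi> \<phi> that by blast
      show "w (\<phi> s) \<noteq> 0" using w(1) \<phi>(1)[OF that] by force
    qed (use I \<phi> that c\<psi> inj in \<open>auto simp: \<phi>_def the_inv_into_f_f\<close>)
    then show ?thesis by (simp add: inverse_eq_divide)
  qed
  have d2\<phi>: "((\<lambda>s. 1 / w (\<phi> s)) has_field_derivative - w' (\<phi> s) / w (\<phi> s) ^ 3) (at s)"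
    if "s \<in> J" for s
  proof -
    have "((\<lambda>s. w (\<phi> s)) has_field_derivative w' (\<phi> s) * (1 / w (\<phi> s))) (at s)"
      using DERIV_chain2[OF w(2)[OF \<phi>(1)[OF that]] d\<phi>[OF that]] .
    moreover have "w (\<phi> s) \<noteq> 0" using w(1) \<phi>(1)[OF that] by force
    ultimately show ?thesis
      by (auto intro!: derivative_eq_intros simp: power3_eq_cube field_simps)
  qed
  have "continuous_on J \<phi>" using d\<phi> by (meson DERIV_isCont continuous_at_imp_continuous_on)
  then have "continuous_on J (\<lambda>s. w (\<phi> s))" "continuous_on J (\<lambda>s. w' (\<phi> s))"
    using \<phi>(1) continuous_on_compose2[OF cw] continuous_on_compose2[OF w'] by blast+
  moreover have "w (\<phi> s) \<noteq> 0" if "s \<in> J" for s using w(1) \<phi>(1)[OF that] by force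
  ultimately have c2: "continuous_on J (\<lambda>s. - w' (\<phi> s) / w (\<phi> s) ^ 3)"
    by (intro continuous_intros) auto
  have C: "Ck_on 2 J \<phi>" "\<And>s. s \<in> J \<Longrightarrow> velocity \<phi> s = 1 / w (\<phi> s)"
    "\<And>s. s \<in> J \<Longrightarrow> velocity (velocity \<phi>) s = - w' (\<phi> s) / w (\<phi> s) ^ 3"
    using Ck_on_2_curveI[of J \<phi> "\<lambda>s. 1 / w (\<phi> s)", OF J(1) _ _ c2] d\<phi> d2\<phi>
    by (simp_all add: has_real_derivative_iff_has_vector_derivative)
  show ?thesis
    by (rule that[OF J C(1) bij C(2,3)])
qed

section \<open>Second derivatives along level curves\<close>

lemma DERIV_along_line:
  fixes f :: "'a::real_normed_vector \<Rightarrow> real"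
  assumes "f differentiable (at (x + s *\<^sub>R u))"
  shows "((\<lambda>s. f (x + s *\<^sub>R u)) has_field_derivative frechet_derivative f (at (x + s *\<^sub>R u)) u) (at s)"
proof -
  let ?D = "frechet_derivative f (at (x + s *\<^sub>R u))"
  have D: "(f has_derivative ?D) (at (x + s *\<^sub>R u))"
    using assms by (simp add: frechet_derivative_works)
  have "((\<lambda>s. x + s *\<^sub>R u) has_derivative (\<lambda>h. h *\<^sub>R u)) (at s)"
    by (auto intro!: derivative_eq_intros)
  from has_derivative_compose[OF this D]
  have "((\<lambda>s. f (x + s *\<^sub>R u)) has_derivative (\<lambda>h. ?D (h *\<^sub>R u))) (at s)" .
  then show ?thesis
    using linear_cmul[OF has_derivative_linear[OF D]]
    by (simp add: has_field_derivative_def mult_commute_abs)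
qed

text \<open>Two applications of the mean value theorem, first along \<open>u\<close> and then along
  \<open>v\<close>, turn the second difference into h^2 times the value of \<open>D u v\<close> at a
  nearby point; continuity of \<open>D u v\<close> does the rest.\<close>

lemma second_difference_limit:
  fixes f :: "'a::euclidean_space \<Rightarrow> real"
  defines "D \<equiv> \<lambda>u v q. frechet_derivative (\<lambda>q. frechet_derivative f (at q) u) (at q) v"
  assumes "Ck_on 2 S f" and S: "open S" "p \<in> S" and "e > 0"
  obtains d where "d > 0" "\<And>h. 0 < h \<Longrightarrow> h < d \<Longrightarrow>
    \<bar>f (p + h *\<^sub>R u + h *\<^sub>R v) - f (p + h *\<^sub>R u) - f (p + h *\<^sub>R v) + f p - h\<^sup>2 * D u v p\<bar> \<le> e * h\<^sup>2"
proof -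
  let ?G = "\<lambda>q. frechet_derivative f (at q) u"
  have df: "f differentiable (at q)" and dG: "?G differentiable (at q)" if "q \<in> S" for q
    using assms(2) that by (simp_all add: numeral_2_eq_2)
  have "continuous_on S (D u v)" using assms(2) by (simp add: numeral_2_eq_2 D_def)
  then have "isCont (D u v) p" using S continuous_on_eq_continuous_at by blast
  then obtain r1 where r1: "r1 > 0" "\<And>q. dist q p < r1 \<Longrightarrow> \<bar>D u v q - D u v p\<bar> < e"
    using \<open>e > 0\<close> unfolding continuous_at_eps_delta dist_real_def by blast
  obtain r2 where r2: "r2 > 0" "ball p r2 \<subseteq> S" using S open_contains_ball by blast
  define r where "r = min r1 r2"
  have r: "r > 0" "\<And>q. dist q p < r \<Longrightarrow> q \<in> S" "\<And>q. dist q p < r \<Longrightarrow> \<bar>D u v q - D u v p\<bar> < e"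
    using r1 r2 by (auto simp: r_def subset_eq dist_commute)
  \<comment> \<open>This bound on h keeps the whole parallelogram spanned at \<open>p\<close> by h u
    and h v within distance \<open>r\<close>. The summand 1 covers u = v = 0.\<close>
  define d where "d = r / (norm u + norm v + 1)"
  have "norm u + norm v + 1 > 0" by (simp add: add_nonneg_pos)
  then have "d > 0" using r(1) by (simp add: d_def)
  moreover have "\<bar>f (p + h *\<^sub>R u + h *\<^sub>R v) - f (p + h *\<^sub>R u) - f (p + h *\<^sub>R v) + f p - h\<^sup>2 * D u v p\<bar> \<le> e * h\<^sup>2"
    if h: "0 < h" "h < d" for h
  proof -
    have near: "dist (p + s *\<^sub>R u + t *\<^sub>R v) p < r" if "0 \<le> s" "s \<le> h" "0 \<le> t" "t \<le> h" for s t
    proof -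
      have "dist (p + s *\<^sub>R u + t *\<^sub>R v) p \<le> norm (s *\<^sub>R u) + norm (t *\<^sub>R v)"
        unfolding dist_norm using norm_triangle_ineq[of "s *\<^sub>R u" "t *\<^sub>R v"] by (simp add: algebra_simps)
      also have "\<dots> \<le> h * norm u + h * norm v"
        using that by (intro add_mono) (auto intro: mult_right_mono)
      also have "\<dots> \<le> h * (norm u + norm v + 1)" using h by (simp add: algebra_simps)
      also have "\<dots> < d * (norm u + norm v + 1)"
        using h(2) \<open>norm u + norm v + 1 > 0\<close> by (rule mult_strict_right_mono)
      also have "\<dots> = r" using \<open>norm u + norm v + 1 > 0\<close> by (simp add: d_def)
      finally show ?thesis .
    qed
    \<comment> \<open>The increment of \<open>f\<close> along \<open>v\<close>, as a function of the
      displacement along \<open>u\<close>; its own increment from 0 to h is the second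
      difference.\<close>
    let ?\<phi> = "\<lambda>s. f (p + h *\<^sub>R v + s *\<^sub>R u) - f (p + s *\<^sub>R u)"
    have in_S: "p + h *\<^sub>R v + s *\<^sub>R u \<in> S" "p + s *\<^sub>R u \<in> S" if "0 \<le> s" "s \<le> h" for s
      using r(2)[OF near[of s h]] r(2)[OF near[of s 0]] that h by (simp_all add: algebra_simps)
    have "\<exists>\<xi>. 0 < \<xi> \<and> \<xi> < h \<and> ?\<phi> h - ?\<phi> 0 = (h - 0) * (?G (p + h *\<^sub>R v + \<xi> *\<^sub>R u) - ?G (p + \<xi> *\<^sub>R u))"
      using h(1) by (intro MVT2 DERIV_diff DERIV_along_line df in_S)
    then obtain \<xi> where \<xi>: "0 < \<xi>" "\<xi> < h"
      "?\<phi> h - ?\<phi> 0 = h * (?G (p + h *\<^sub>R v + \<xi> *\<^sub>R u) - ?G (p + \<xi> *\<^sub>R u))" by auto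
    have "\<exists>\<eta>. 0 < \<eta> \<and> \<eta> < h \<and>
        ?G (p + \<xi> *\<^sub>R u + h *\<^sub>R v) - ?G (p + \<xi> *\<^sub>R u + 0 *\<^sub>R v) = (h - 0) * D u v (p + \<xi> *\<^sub>R u + \<eta> *\<^sub>R v)"
      unfolding D_def using h(1) \<xi> r(2)[OF near]
      by (intro MVT2 DERIV_along_line dG) auto
    then obtain \<eta> where \<eta>: "0 < \<eta>" "\<eta> < h"
        "?G (p + \<xi> *\<^sub>R u + h *\<^sub>R v) - ?G (p + \<xi> *\<^sub>R u) = h * D u v (p + \<xi> *\<^sub>R u + \<eta> *\<^sub>R v)" by auto
    have "?\<phi> h - ?\<phi> 0 = h\<^sup>2 * D u v (p + \<xi> *\<^sub>R u + \<eta> *\<^sub>R v)"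
      using \<xi>(3) \<eta>(3) by (simp add: power2_eq_square algebra_simps)
    then have "f (p + h *\<^sub>R u + h *\<^sub>R v) - f (p + h *\<^sub>R u) - f (p + h *\<^sub>R v) + f p - h\<^sup>2 * D u v p =
        h\<^sup>2 * (D u v (p + \<xi> *\<^sub>R u + \<eta> *\<^sub>R v) - D u v p)"
      by (simp add: algebra_simps)
    moreover have "\<bar>D u v (p + \<xi> *\<^sub>R u + \<eta> *\<^sub>R v) - D u v p\<bar> \<le> e"
      using r(3)[OF near[of \<xi> \<eta>]] \<xi> \<eta> by simp
    ultimately show ?thesis
      by (simp add: abs_mult mult.commute[of e] mult_left_mono)
  qed
  ultimately show ?thesis by (rule that)
qed

text \<open>The second difference does not change when \<open>u\<close> and \<open>v\<close> are
  swapped, yet divided by h^2 it approximates both iterated derivatives.\<close>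

lemma second_derivative_symmetric:
  fixes f :: "'a::euclidean_space \<Rightarrow> real"
  assumes "Ck_on 2 S f" and S: "open S" "p \<in> S"
  shows "frechet_derivative (\<lambda>q. frechet_derivative f (at q) u) (at p) v =
    frechet_derivative (\<lambda>q. frechet_derivative f (at q) v) (at p) u"
    (is "?A = ?B")
proof (rule ccontr)
  assume "?A \<noteq> ?B"
  \<comment> \<open>The two errors add up to at most \<open>2 * e\<close>, half of the supposed gap,
    which is a contradiction.\<close>
  define e where "e = \<bar>?A - ?B\<bar> / 4"
  have "e > 0" using \<open>?A \<noteq> ?B\<close> by (simp add: e_def)
  obtain d1 where d1: "d1 > 0" "\<And>h. 0 < h \<Longrightarrow> h < d1 \<Longrightarrow>
    \<bar>f (p + h *\<^sub>R u + h *\<^sub>R v) - f (p + h *\<^sub>R u) - f (p + h *\<^sub>R v) + f p - h\<^sup>2 * ?A\<bar> \<le> e * h\<^sup>2"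
    using second_difference_limit[OF assms \<open>e > 0\<close>, of u v] by blast
  obtain d2 where d2: "d2 > 0" "\<And>h. 0 < h \<Longrightarrow> h < d2 \<Longrightarrow>
    \<bar>f (p + h *\<^sub>R v + h *\<^sub>R u) - f (p + h *\<^sub>R v) - f (p + h *\<^sub>R u) + f p - h\<^sup>2 * ?B\<bar> \<le> e * h\<^sup>2"
    using second_difference_limit[OF assms \<open>e > 0\<close>, of v u] by blast
  define h where "h = min d1 d2 / 2"
  have h: "0 < h" "h < d1" "h < d2" using d1(1) d2(1) by (auto simp: h_def min_def)
  have "p + h *\<^sub>R v + h *\<^sub>R u = p + h *\<^sub>R u + h *\<^sub>R v" by (simp add: algebra_simps)
  with d2(2)[OF h(1,3)]
  have "\<bar>f (p + h *\<^sub>R u + h *\<^sub>R v) - f (p + h *\<^sub>R v) - f (p + h *\<^sub>R u) + f p - h\<^sup>2 * ?B\<bar> \<le> e * h\<^sup>2"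
    by simp
  then have "\<bar>h\<^sup>2 * ?A - h\<^sup>2 * ?B\<bar> \<le> e * h\<^sup>2 + e * h\<^sup>2"
    using d1(2)[OF h(1,2)] by linarith
  then have "h\<^sup>2 * \<bar>?A - ?B\<bar> \<le> h\<^sup>2 * (2 * e)"
    by (simp add: abs_mult mult.commute[of e] flip: right_diff_distrib)
  then have "\<bar>?A - ?B\<bar> \<le> 2 * e" using h(1) by simp
  then show False using \<open>e > 0\<close> by (simp add: e_def)
qed

lemma Ck_on_2_partials:
  fixes f :: "real ^ 'n::finite \<Rightarrow> real"
  assumes f: "Ck_on 2 S f" and S: "open S"
  shows "\<And>p. p \<in> S \<Longrightarrow> f differentiable (at p)"
    and "\<And>p i. p \<in> S \<Longrightarrow> partial i f differentiable (at p)"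
    and "\<And>i j. continuous_on S (partial i (partial j f))"
    and "\<And>p i j. p \<in> S \<Longrightarrow> partial i (partial j f) p = partial j (partial i f) p"
  using f second_derivative_symmetric[OF f S]
  by (simp_all add: numeral_2_eq_2 partial_def[abs_def])

lemma Ck_on_2_continuous_partial:
  fixes f :: "real ^ 'n::finite \<Rightarrow> real"
  assumes "Ck_on 2 S f" "open S"
  shows "continuous_on S (partial i f)"
  using Ck_on_2_partials(2)[OF assms]
  by (meson continuous_at_imp_continuous_on differentiable_imp_continuous_within)

section \<open>Differentiation along curves and the curvature of level curves\<close>

lemma DERIV_along_curve:
  fixes f :: "real ^ 2 \<Rightarrow> real"
  assumes "f differentiable (at (\<gamma> t))" and "(\<gamma> has_vector_derivative v) (at t)"
  shows "((\<lambda>t. f (\<gamma> t)) has_field_derivative (partial 1 f (\<gamma> t) * v $ 1 + partial 2 f (\<gamma> t) * v $ 2)) (at t)"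
proof -
  have "((\<lambda>t. f (\<gamma> t)) has_derivative
      (\<lambda>x. (x *\<^sub>R v) $ 1 *\<^sub>R partial 1 f (\<gamma> t) + (x *\<^sub>R v) $ 2 *\<^sub>R partial 2 f (\<gamma> t))) (at t)"
    by (rule has_derivative_compose[OF assms(2)[unfolded has_vector_derivative_def]
        has_derivative_partials[OF assms(1)]])
  then show ?thesis
    by (rule has_derivative_imp_has_field_derivative) (simp add: algebra_simps)
qed

lemma DERIV_vec_nth:
  "(\<gamma> has_vector_derivative v) (at t) \<Longrightarrow> ((\<lambda>t. \<gamma> t $ k) has_field_derivative v $ k) (at t)"
  for \<gamma> :: "real \<Rightarrow> real ^ 'n::finite"
  using bounded_linear.has_vector_derivative[OF bounded_linear_vec_nth]
  by (simp add: has_real_derivative_iff_has_vector_derivative)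

lemma vector_2_axis: "vector [a, b] = a *\<^sub>R axis 1 1 + b *\<^sub>R (axis 2 1 :: real ^ 2)"
  by (simp add: vec_eq_iff forall_2 axis_def)

lemma has_vector_derivative_vector_2:
  assumes "(f has_field_derivative f') (at t)" "(g has_field_derivative g') (at t)"
  shows "((\<lambda>t. vector [f t, g t] :: real ^ 2) has_vector_derivative vector [f', g']) (at t)"
unfolding vector_2_axis using assms by (auto intro!: derivative_eq_intros)

lemma continuous_on_vector_2:
  assumes "continuous_on S f" "continuous_on S g"
  shows "continuous_on S (\<lambda>t. vector [f t, g t] :: real ^ 2)"
unfolding vector_2_axis by (intro continuous_intros assms)

text \<open>These are the first and second derivatives of the constant function f o \<gamma>;
  symmetry of the mixed partials merges the two cross terms.\<close>

lemma level_curve_derivatives: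
  fixes f :: "real ^ 2 \<Rightarrow> real"
  assumes f: "Ck_on 2 \<Omega> f" "open \<Omega>" and lc: "level_curve \<Omega> f I \<gamma>" and t: "t \<in> I"
  defines "v \<equiv> velocity \<gamma> t" and "A \<equiv> velocity (velocity \<gamma>) t" and "p \<equiv> \<gamma> t"
  shows "partial 1 f p * v $ 1 + partial 2 f p * v $ 2 = 0"
    and "partial 1 (partial 1 f) p * (v $ 1)\<^sup>2 + 2 * partial 1 (partial 2 f) p * v $ 1 * v $ 2
      + partial 2 (partial 2 f) p * (v $ 2)\<^sup>2 + partial 1 f p * A $ 1 + partial 2 f p * A $ 2 = 0"
proof -
  have \<gamma>: "Ck_on 2 I \<gamma>" "open I" and in_\<Omega>: "\<And>s. s \<in> I \<Longrightarrow> \<gamma> s \<in> \<Omega>"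
    using lc by (auto simp: level_curve_def regular_curve_def)
  have "(f \<circ> \<gamma>) constant_on I" using lc by (simp add: level_curve_def)
  then obtain c where c: "\<And>s. s \<in> I \<Longrightarrow> f (\<gamma> s) = c"
    unfolding constant_on_def by (metis comp_apply)
  note D = Ck_on_2_curveD[OF \<gamma>] and P = Ck_on_2_partials[OF f]
  have const: "g' = 0" if "(g has_field_derivative g') (at s)" "s \<in> I" "\<And>s. s \<in> I \<Longrightarrow> g s = k"
    for g :: "real \<Rightarrow> real" and g' k s
  proof -
    have "((\<lambda>s. k) has_field_derivative g') (at s)"
      by (rule has_field_derivative_transform_within_open[OF that(1) \<gamma>(2) that(2) that(3)])
    then show ?thesis by (rule DERIV_unique[OF _ DERIV_const])
  qed
  have 1: "partial 1 f (\<gamma> s) * velocity \<gamma> s $ 1 + partial 2 f (\<gamma> s) * velocity \<gamma> s $ 2 = 0"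
    if "s \<in> I" for s
    using const[OF DERIV_along_curve[OF P(1) D(1)]] that in_\<Omega> c by blast
  show "partial 1 f p * v $ 1 + partial 2 f p * v $ 2 = 0"
    using 1[OF t] by (simp add: p_def v_def)
  have dP: "((\<lambda>s. partial i f (\<gamma> s)) has_field_derivative
      (partial 1 (partial i f) p * v $ 1 + partial 2 (partial i f) p * v $ 2)) (at t)" for i
    unfolding p_def v_def by (intro DERIV_along_curve P(2) D(1) in_\<Omega> t)
  have dv: "((\<lambda>s. velocity \<gamma> s $ i) has_field_derivative A $ i) (at t)" for i
    unfolding A_def by (intro DERIV_vec_nth D(2) t)
  have "((\<lambda>s. partial 1 f (\<gamma> s) * velocity \<gamma> s $ 1 + partial 2 f (\<gamma> s) * velocity \<gamma> s $ 2)
     has_field_derivative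
      (partial 1 (partial 1 f) p * v $ 1 + partial 2 (partial 1 f) p * v $ 2) * v $ 1 + A $ 1 * partial 1 f p
    + ((partial 1 (partial 2 f) p * v $ 1 + partial 2 (partial 2 f) p * v $ 2) * v $ 2 + A $ 2 * partial 2 f p)) (at t)"
    using DERIV_add[OF DERIV_mult[OF dP dv] DERIV_mult[OF dP dv]] by (simp only: p_def v_def)
  from const[OF this t 1]
  have "(partial 1 (partial 1 f) p * v $ 1 + partial 2 (partial 1 f) p * v $ 2) * v $ 1 + A $ 1 * partial 1 f p
    + ((partial 1 (partial 2 f) p * v $ 1 + partial 2 (partial 2 f) p * v $ 2) * v $ 2 + A $ 2 * partial 2 f p) = 0" .
  moreover have "partial 2 (partial 1 f) p = partial 1 (partial 2 f) p"
    using P(4) in_\<Omega> t by (simp add: p_def)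
  ultimately show "partial 1 (partial 1 f) p * (v $ 1)\<^sup>2 + 2 * partial 1 (partial 2 f) p * v $ 1 * v $ 2
      + partial 2 (partial 2 f) p * (v $ 2)\<^sup>2 + partial 1 f p * A $ 1 + partial 2 f p * A $ 2 = 0"
    by (simp add: power2_eq_square algebra_simps)
qed

text \<open>Up to a positive factor, the geodesic curvature of the level curve through \<open>p\<close>, the
  tangent being \<open>(- f\<^sub>y, f\<^sub>x)\<close>.\<close>

definition level_curvature :: "(real ^ 2 \<Rightarrow> real) \<Rightarrow> real ^ 2 \<Rightarrow> real"
  where "level_curvature f p =
    (partial 2 f p)\<^sup>2 * partial 1 (partial 1 f) p
      - 2 * partial 1 f p * partial 2 f p * partial 1 (partial 2 f) p
      + (partial 1 f p)\<^sup>2 * partial 2 (partial 2 f) p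
      - partial 2 f p * ((partial 1 f p)\<^sup>2 + (partial 2 f p)\<^sup>2) / p $ 2"

text \<open>The velocity is a multiple of \<open>(- f\<^sub>y, f\<^sub>x)\<close> only where the gradient is nonzero; the
  factors are cleared so that no division occurs.\<close>

lemma level_curve_acceleration:
  fixes f :: "real ^ 2 \<Rightarrow> real"
  assumes f: "Ck_on 2 \<Omega> f" "open \<Omega>" "\<Omega> \<subseteq> H2" and lc: "level_curve \<Omega> f I \<gamma>" and t: "t \<in> I"
  defines "v \<equiv> velocity \<gamma> t" and "W \<equiv> covariant_acceleration H2_metric \<gamma> t" and "p \<equiv> \<gamma> t"
  shows "((partial 1 f p)\<^sup>2 + (partial 2 f p)\<^sup>2)\<^sup>2 * (partial 1 f p * W $ 1 + partial 2 f p * W $ 2) =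
    - (partial 1 f p * v $ 2 - partial 2 f p * v $ 1)\<^sup>2 * level_curvature f p"
proof -
  have "p $ 2 > 0" using lc t f(3) by (auto simp: level_curve_def p_def H2_def)
  define A where "A = velocity (velocity \<gamma>) t"
  define a b r s q y where "a = partial 1 f p" and "b = partial 2 f p"
    and "r = partial 1 (partial 1 f) p" and "s = partial 1 (partial 2 f) p"
    and "q = partial 2 (partial 2 f) p" and "y = p $ 2"
  note defs = a_def b_def r_def s_def q_def y_def
  define v1 v2 where "v1 = v $ 1" and "v2 = v $ 2"
  \<comment> \<open>The Euclidean product of the velocity with the rotated gradient (-b, a). As the
    velocity is orthogonal to (a, b), it becomes \<open>m\<close> times (-b, a) after multiplication
    by a^2 + b^2.\<close>
  define m where "m = a * v2 - b * v1"
  have 1: "a * v1 + b * v2 = 0"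
    and 2: "r * v1\<^sup>2 + 2 * s * v1 * v2 + q * v2\<^sup>2 + a * A $ 1 + b * A $ 2 = 0"
    using level_curve_derivatives[OF f(1,2) lc t]
    by (simp_all add: defs v1_def v2_def v_def A_def p_def)
  have v: "(a\<^sup>2 + b\<^sup>2) * v1 = - b * m" "(a\<^sup>2 + b\<^sup>2) * v2 = a * m"
    using 1 unfolding m_def by algebra+
  \<comment> \<open>A name for the inverse makes the identities below polynomial.\<close>
  define z where "z = inverse y"
  have W: "W $ 1 = A $ 1 - 2 * v1 * v2 * z" "W $ 2 = A $ 2 + (v1\<^sup>2 - v2\<^sup>2) * z"
    using \<open>p $ 2 > 0\<close>
    by (simp_all add: W_def covariant_acceleration_def A_def v1_def v2_def v_def p_def y_def z_def
        christoffel_term_H2 power2_eq_square divide_inverse)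
  \<comment> \<open>The expression is homogeneous of degree two in the velocity, so the factor N^2
    can be absorbed into it; for N = a^2 + b^2 the scaled velocity is known.\<close>
  have scale: "N\<^sup>2 * (- (r * v1\<^sup>2 + 2 * s * v1 * v2 + q * v2\<^sup>2) + (b * (v1\<^sup>2 - v2\<^sup>2) - 2 * a * v1 * v2) * z) =
      - (r * (N * v1)\<^sup>2 + 2 * s * (N * v1) * (N * v2) + q * (N * v2)\<^sup>2)
      + (b * ((N * v1)\<^sup>2 - (N * v2)\<^sup>2) - 2 * a * (N * v1) * (N * v2)) * z" for N
    by algebra
  have "a * W $ 1 + b * W $ 2 =
      - (r * v1\<^sup>2 + 2 * s * v1 * v2 + q * v2\<^sup>2) + (b * (v1\<^sup>2 - v2\<^sup>2) - 2 * a * v1 * v2) * z"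
    using 2 unfolding W by algebra
  then have "(a\<^sup>2 + b\<^sup>2)\<^sup>2 * (a * W $ 1 + b * W $ 2) =
      - (r * (- b * m)\<^sup>2 + 2 * s * (- b * m) * (a * m) + q * (a * m)\<^sup>2)
      + (b * ((- b * m)\<^sup>2 - (a * m)\<^sup>2) - 2 * a * (- b * m) * (a * m)) * z"
    using scale[of "a\<^sup>2 + b\<^sup>2"] unfolding v by simp
  also have "\<dots> = - m\<^sup>2 * (b\<^sup>2 * r - 2 * a * b * s + a\<^sup>2 * q - b * (a\<^sup>2 + b\<^sup>2) / y)"
    unfolding divide_inverse z_def[symmetric] by algebra
  finally show ?thesis
    by (simp add: level_curvature_def defs m_def v1_def v2_def)
qed

section \<open>Existence of level curves and isolation of critical points\<close>

text \<open>The local inverse is obtained with a first derivative only. Solving for the velocity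
  expresses it through the first partials of \<open>f\<close> along the curve; these are
  differentiable there, which yields the second derivative.\<close>

lemma level_curve_through_regular_point:
  fixes f :: "real ^ 2 \<Rightarrow> real"
  assumes f: "Ck_on 2 \<Omega> f" "open \<Omega>" and p: "p \<in> \<Omega>" "partial 1 f p \<noteq> 0 \<or> partial 2 f p \<noteq> 0"
  obtains I \<gamma> where "level_curve \<Omega> f I \<gamma>" "0 \<in> I" "\<gamma> 0 = p"
proof -
  note P = Ck_on_2_partials[OF f] and cP = Ck_on_2_continuous_partial[OF f]
  define a b where "a = partial 1 f p" and "b = partial 2 f p"
  define N where "N = a\<^sup>2 + b\<^sup>2"
  have N: "N > 0" using p(2) by (auto simp: N_def a_def b_def sum_power2_gt_zero_iff)
  \<comment> \<open>Up to sign, \<delta> is the determinant of the derivative of the map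
    \<open>F\<close> below, so \<open>U\<close> is where that derivative is invertible. At
    \<open>p\<close> its value is \<open>N\<close>.\<close>
  define \<delta> where "\<delta> q = a * partial 1 f q + b * partial 2 f q" for q
  define U where "U = {q \<in> \<Omega>. \<delta> q \<noteq> 0}"
  have c\<delta>: "continuous_on \<Omega> \<delta>" unfolding \<delta>_def by (intro continuous_intros cP)
  have "U = \<Omega> \<inter> \<delta> -` (- {0})" by (auto simp: U_def)
  then have "open U" using continuous_open_preimage[OF c\<delta> f(2) open_Compl[OF closed_singleton]] by simp
  have "p \<in> U" using p by (auto simp: U_def \<delta>_def a_def b_def)
  have U_sub: "U \<subseteq> \<Omega>" by (auto simp: U_def)
  \<comment> \<open>The first coordinate of \<open>F\<close> is linear along the level direction at \<open>p\<close>; the level curve is the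
    image of a horizontal line under the local inverse of \<open>F\<close>.\<close>
  define F where "F q = (vector [- b * q $ 1 + a * q $ 2, f q] :: real ^ 2)" for q
  define L where "L q h = (vector [- b * h $ 1 + a * h $ 2, h $ 1 * partial 1 f q + h $ 2 * partial 2 f q] :: real ^ 2)"
    for q h :: "real ^ 2"
  have dF: "(F has_derivative L q) (at q)" if "q \<in> \<Omega>" for q
    unfolding F_def[abs_def] L_def[abs_def] vector_2_axis
    using has_derivative_partials[OF P(1)[OF that]]
    by (intro derivative_intros has_derivative_vec_nth_at) (simp_all add: has_derivative_vec_nth_at)
  have bL: "bounded_linear (L q)" for q
    unfolding L_def[abs_def] vector_2_axis
    by (intro bounded_linear_add bounded_linear_scaleR_const bounded_linear_const_mult
       bounded_linear_mult_const bounded_linear_vec_nth)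
  define F' where "F' q = Blinfun (L q)" for q
  have F': "blinfun_apply (F' q) = L q" for q
    by (simp add: F'_def bounded_linear_Blinfun_apply bL)
  have cF': "continuous_on U F'"
    by (rule continuous_on_blinfun_componentwise)
      (auto simp: F' L_def intro!: continuous_on_vector_2 continuous_intros continuous_on_subset[OF cP U_sub])
  \<comment> \<open>The matrix of \<open>L p\<close> has rows (-b, a) and (a, b), and its square is
    \<open>N\<close> times the identity; hence \<open>R\<close> is \<open>L p\<close> divided by
    \<open>N\<close>.\<close>
  define R where "R w = (vector [(- b * w $ 1 + a * w $ 2) / N, (a * w $ 1 + b * w $ 2) / N] :: real ^ 2)" for w :: "real ^ 2"
  have bR: "bounded_linear R"
    unfolding R_def[abs_def] vector_2_axis divide_inverse
    by (intro bounded_linear_add bounded_linear_scaleR_const bounded_linear_const_mult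
       bounded_linear_mult_const bounded_linear_vec_nth)
  have RL: "R (L p h) = h" for h
  proof -
    have "(- b * (- b * h $ 1 + a * h $ 2) + a * (h $ 1 * a + h $ 2 * b)) = N * h $ 1"
      "(a * (- b * h $ 1 + a * h $ 2) + b * (h $ 1 * a + h $ 2 * b)) = N * h $ 2"
      by (simp_all add: N_def power2_eq_square algebra_simps)
    then show ?thesis
      using N by (simp add: vec_eq_iff forall_2 R_def L_def flip: a_def b_def)
  qed
  have inv: "Blinfun R o\<^sub>L F' p = id_blinfun"
    by (rule blinfun_eqI) (simp add: F' bounded_linear_Blinfun_apply bR RL)
  have dF': "(F has_derivative blinfun_apply (F' q)) (at q)" if "q \<in> U" for q
    using dF that U_sub by (auto simp: F')
  obtain U' V g g' where ift: "open U'" "U' \<subseteq> U" "p \<in> U'" "open V" "F p \<in> V" "homeomorphism U' V F g"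
    "\<And>y. y \<in> V \<Longrightarrow> (g has_derivative g' y) (at y)"
    "\<And>y. y \<in> V \<Longrightarrow> g' y = inv (blinfun_apply (F' (g y)))"
    "\<And>y. y \<in> V \<Longrightarrow> bij (blinfun_apply (F' (g y)))"
    by (rule inverse_function_theorem[OF \<open>open U\<close> dF' cF' \<open>p \<in> U\<close> inv]) blast+
  define \<sigma> where "\<sigma> t = F p + t *\<^sub>R axis 1 1" for t :: real
  obtain e where e: "e > 0" "ball (F p) e \<subseteq> V" using ift(4,5) open_contains_ball by blast
  define I where "I = {- e<..<e}"
  have \<sigma>V: "\<sigma> t \<in> V" if "t \<in> I" for t
    using that e(2) by (auto simp: \<sigma>_def I_def subset_eq dist_norm)
  define \<gamma> where "\<gamma> t = g (\<sigma> t)" for t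
  have \<gamma>U: "\<gamma> t \<in> U" if "t \<in> I" for t
    using \<sigma>V[OF that] ift(2,6) unfolding \<gamma>_def homeomorphism_def by blast
  then have \<gamma>\<Omega>: "\<gamma> t \<in> \<Omega>" and \<delta>\<gamma>: "\<delta> (\<gamma> t) \<noteq> 0" if "t \<in> I" for t
    using that by (auto simp: U_def)
  have F\<gamma>: "F (\<gamma> t) = \<sigma> t" if "t \<in> I" for t
    using \<sigma>V[OF that] ift(6) by (simp add: \<gamma>_def homeomorphism_apply2)
  have f\<gamma>: "f (\<gamma> t) = f p" if "t \<in> I" for t
    using arg_cong[OF F\<gamma>[OF that], of "\<lambda>w. w $ 2"] by (simp add: F_def \<sigma>_def axis_def)
  define A B where "A t = partial 1 f (\<gamma> t)" and "B t = partial 2 f (\<gamma> t)" for t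
  \<comment> \<open>Cramer's rule for the system L (\<gamma> t) u = (1, 0), which the velocity
    satisfies because F o \<gamma> = \<sigma>.\<close>
  define \<gamma>' where "\<gamma>' t = (vector [- B t / \<delta> (\<gamma> t), A t / \<delta> (\<gamma> t)] :: real ^ 2)" for t
  have d\<gamma>: "(\<gamma> has_vector_derivative \<gamma>' t) (at t)" if "t \<in> I" for t
  proof -
    let ?u = "g' (\<sigma> t) (axis 1 1)"
    have dg: "(g has_derivative g' (\<sigma> t)) (at (\<sigma> t))" using ift(7) \<sigma>V that by blast
    have "(\<sigma> has_derivative (\<lambda>x. x *\<^sub>R axis 1 1)) (at t)"
      unfolding \<sigma>_def[abs_def] by (auto intro!: derivative_eq_intros)
    from has_derivative_compose[OF this dg]
    have "(\<gamma> has_vector_derivative ?u) (at t)"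
      using linear_cmul[OF has_derivative_linear[OF dg]]
      by (simp add: \<gamma>_def[abs_def] has_vector_derivative_def)
    moreover have "L (\<gamma> t) ?u = axis 1 1"
      using ift(8,9)[OF \<sigma>V[OF that]] bij_is_surj surj_f_inv_f unfolding F' \<gamma>_def by metis
    then have u: "- b * ?u $ 1 + a * ?u $ 2 = 1" "?u $ 1 * A t + ?u $ 2 * B t = 0"
      by (simp_all add: L_def vec_eq_iff forall_2 axis_def A_def B_def)
    have "?u $ 1 * \<delta> (\<gamma> t) = - B t" "?u $ 2 * \<delta> (\<gamma> t) = A t"
      using u unfolding \<delta>_def A_def[symmetric] B_def[symmetric] by algebra+
    then have "?u = \<gamma>' t"
      using \<delta>\<gamma>[OF that] by (simp add: \<gamma>'_def vec_eq_iff forall_2 field_simps)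
    ultimately show ?thesis by simp
  qed
  define A' B' where "A' t = partial 1 (partial 1 f) (\<gamma> t) * \<gamma>' t $ 1 + partial 2 (partial 1 f) (\<gamma> t) * \<gamma>' t $ 2"
    and "B' t = partial 1 (partial 2 f) (\<gamma> t) * \<gamma>' t $ 1 + partial 2 (partial 2 f) (\<gamma> t) * \<gamma>' t $ 2" for t
  have dA: "(A has_field_derivative A' t) (at t)" and dB: "(B has_field_derivative B' t) (at t)"
    if "t \<in> I" for t
    unfolding A_def[abs_def] B_def[abs_def] A'_def B'_def
    using that by (intro DERIV_along_curve P(2) \<gamma>\<Omega> d\<gamma>; simp)+
  define D D' where "D t = a * A t + b * B t" and "D' t = a * A' t + b * B' t" for t
  have dD: "(D has_field_derivative D' t) (at t)" if "t \<in> I" for t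
    unfolding D_def[abs_def] D'_def using dA[OF that] dB[OF that] by (intro DERIV_add DERIV_cmult)
  have D: "\<delta> (\<gamma> t) = D t" for t by (simp add: D_def \<delta>_def A_def B_def)
  define \<gamma>'' where "\<gamma>'' t = (vector [(- B' t * D t - - B t * D' t) / (D t * D t),
      (A' t * D t - A t * D' t) / (D t * D t)] :: real ^ 2)" for t
  have d\<gamma>': "(\<gamma>' has_vector_derivative \<gamma>'' t) (at t)" if "t \<in> I" for t
    unfolding \<gamma>'_def[abs_def] \<gamma>''_def D
    using dA[OF that] dB[OF that] dD[OF that] \<delta>\<gamma>[OF that] unfolding D
    by (intro has_vector_derivative_vector_2 DERIV_divide DERIV_minus)
  have c\<gamma>: "continuous_on I \<gamma>" "continuous_on I \<gamma>'"
    using d\<gamma> d\<gamma>' by (meson continuous_at_imp_continuous_on has_vector_derivative_continuous)+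
  have cc: "continuous_on I (\<lambda>t. partial i (partial j f) (\<gamma> t))" for i j
    using continuous_on_compose2[OF P(3) c\<gamma>(1)] \<gamma>\<Omega> by blast
  have cA: "continuous_on I A" "continuous_on I B" "continuous_on I D"
    using dA dB dD by (meson DERIV_isCont continuous_at_imp_continuous_on)+
  have cA': "continuous_on I A'" "continuous_on I B'"
    unfolding A'_def[abs_def] B'_def[abs_def] by (intro continuous_intros cc c\<gamma>)+
  then have "continuous_on I D'" unfolding D'_def[abs_def] by (intro continuous_intros)
  then have c\<gamma>'': "continuous_on I \<gamma>''"
    unfolding \<gamma>''_def[abs_def] using \<delta>\<gamma> unfolding D
    by (intro continuous_on_vector_2 continuous_intros cA cA') auto
  have I: "open I" "is_interval I" "0 \<in> I" using e(1) by (auto simp: I_def)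
  have "velocity \<gamma> t \<noteq> 0" if "t \<in> I" for t
  proof
    assume "velocity \<gamma> t = 0"
    then have "\<gamma>' t = 0" using velocity_eq[OF d\<gamma>[OF that]] by simp
    then have "A t = 0" "B t = 0" using \<delta>\<gamma>[OF that] by (simp_all add: \<gamma>'_def vec_eq_iff forall_2)
    then show False using \<delta>\<gamma>[OF that] unfolding D by (simp add: D_def)
  qed
  then have "level_curve \<Omega> f I \<gamma>"
    using Ck_on_2_curveI(1)[OF I(1) d\<gamma> d\<gamma>' c\<gamma>''] I \<gamma>\<Omega> f\<gamma>
    by (auto simp: level_curve_def regular_curve_def constant_on_def)
  moreover have "\<gamma> 0 = p"
    using ift(3,6) by (simp add: \<gamma>_def \<sigma>_def homeomorphism_apply1)
  ultimately show ?thesis using I(3) that by blast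
qed

text \<open>\<open>E\<close> and \<open>C\<close> identify the real plane with the complex plane
  isometrically, so the ball on which a zero of \<open>G\<close> is isolated carries over with the
  same radius.\<close>

lemma harmonic_critical_point_isolated:
  fixes f :: "real ^ 2 \<Rightarrow> real"
  assumes f: "Ck_on 2 \<Omega> f" "open \<Omega>" and "connected \<Omega>" and nc: "\<not> f constant_on \<Omega>"
    and harm: "\<And>q. q \<in> \<Omega> \<Longrightarrow> flat_laplacian f q = 0"
    and p: "p \<in> \<Omega>" "partial 1 f p = 0" "partial 2 f p = 0"
  obtains r where "r > 0"
    "\<And>q. q \<in> ball p r - {p} \<Longrightarrow> q \<in> \<Omega> \<and> (partial 1 f q \<noteq> 0 \<or> partial 2 f q \<noteq> 0)"
proof -
  note P = Ck_on_2_partials[OF f]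
  define E where "E z = (vector [Re z, Im z] :: real ^ 2)" for z
  define C where "C q = Complex (q $ 1) (q $ 2)" for q :: "real ^ 2"
  have EC: "E (C q) = q" and CE: "C (E z) = z" for q z
    by (simp_all add: E_def C_def vec_eq_iff forall_2)
  have dE: "(E has_derivative E) F" for F
    unfolding E_def[abs_def] vector_2_axis by (auto intro!: derivative_eq_intros)
  have cE: "continuous_on UNIV E"
    by (meson continuous_at_imp_continuous_on dE has_derivative_continuous)
  have cC: "continuous_on UNIV C"
    unfolding C_def[abs_def] Complex_eq by (intro continuous_intros)
  have dist_C: "dist (C q) (C q') = dist q q'" for q q'
    by (simp add: dist_norm C_def norm_vec_def L2_set_def sum_2 complex_norm minus_complex.code)
  define S where "S = E -` \<Omega>"
  have S: "S = C ` \<Omega>" unfolding S_def set_eq_iff image_iff vimage_eq using EC CE by metis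
  have "open S" unfolding S_def using open_vimage[OF f(2)] cE by blast
  have "connected S"
    unfolding S using connected_continuous_image assms(3) cC continuous_on_subset by blast
  \<comment> \<open>\<open>G = f\<^sub>x - \<i> f\<^sub>y\<close>, for which the Cauchy-Riemann equations are harmonicity and
    the symmetry of the mixed derivatives\<close>
  define G where "G z = Complex (partial 1 f (E z)) (- partial 2 f (E z))" for z
  have dG: "(G has_field_derivative
      Complex (partial 1 (partial 1 f) (E z)) (- partial 1 (partial 2 f) (E z))) (at z)"
    if "z \<in> S" for z
  proof -
    let ?q = "E z"
    have q: "?q \<in> \<Omega>" using that by (simp add: S_def)
    have d: "((\<lambda>z. partial i f (E z)) has_derivative
        (\<lambda>h. Re h * partial 1 (partial i f) ?q + Im h * partial 2 (partial i f) ?q)) (at z)" for i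
      using has_derivative_compose[OF dE has_derivative_partials[OF P(2)[OF q]]] by (simp add: E_def)
    have "(G has_derivative (\<lambda>h. of_real (Re h * partial 1 (partial 1 f) ?q + Im h * partial 2 (partial 1 f) ?q)
        + \<i> * of_real (- (Re h * partial 1 (partial 2 f) ?q + Im h * partial 2 (partial 2 f) ?q)))) (at z)"
      unfolding G_def[abs_def] Complex_eq
      by (intro derivative_intros d)
    moreover have "partial 2 (partial 1 f) ?q = partial 1 (partial 2 f) ?q" using P(4) q by blast
    moreover have "partial 2 (partial 2 f) ?q = - partial 1 (partial 1 f) ?q"
      using harm[OF q] by (simp add: flat_laplacian_def)
    ultimately show ?thesis
      unfolding has_field_derivative_def
      by (elim has_derivative_eq_rhs) (simp add: complex_eq_iff fun_eq_iff algebra_simps)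
  qed
  then have holo: "G holomorphic_on S"
    using \<open>open S\<close> by (meson holomorphic_on_open)
  \<comment> \<open>Isolation of zeros requires a point where \<open>G\<close> is nonzero. Without
    one, the derivative of \<open>f\<close> would vanish on the connected domain and
    \<open>f\<close> would be constant.\<close>
  have "\<exists>q\<in>\<Omega>. partial 1 f q \<noteq> 0 \<or> partial 2 f q \<noteq> 0"
  proof (rule ccontr)
    assume "\<not> ?thesis"
    then have zero: "(f has_derivative (\<lambda>h. 0)) (at q within \<Omega>)" if "q \<in> \<Omega>" for q
      using has_derivative_partials[OF P(1)[OF that]] that by (simp add: has_derivative_at_withinI)
    then have "continuous_on \<Omega> f"
      by (meson continuous_on_eq_continuous_within has_derivative_continuous)
    then have "f constant_on \<Omega>"
      using has_derivative_zero_connected_constant_on[of \<Omega> "{}" f] assms(3) f(2) zero by simp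
    then show False using nc by blast
  qed
  then obtain q where q: "q \<in> \<Omega>" "partial 1 f q \<noteq> 0 \<or> partial 2 f q \<noteq> 0" by blast
  have "C p \<in> S" "G (C p) = 0" "C q \<in> S" "G (C q) \<noteq> 0"
    using p q by (auto simp: S_def EC G_def complex_eq_iff)
  from isolated_zeros[OF holo \<open>open S\<close> \<open>connected S\<close> this]
  obtain r where r: "0 < r" "ball (C p) r \<subseteq> S" "\<And>z. z \<in> ball (C p) r - {C p} \<Longrightarrow> G z \<noteq> 0"
    by blast
  show ?thesis
  proof (rule that[OF r(1)])
    fix x assume x: "x \<in> ball p r - {p}"
    have "C x \<noteq> C p" using x EC by (metis DiffD2 singletonI)
    then have "C x \<in> ball (C p) r - {C p}" using x by (simp add: dist_C)
    then have "C x \<in> S" "G (C x) \<noteq> 0" using r by blast+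
    then show "x \<in> \<Omega> \<and> (partial 1 f x \<noteq> 0 \<or> partial 2 f x \<noteq> 0)"
      by (auto simp: S_def EC G_def complex_eq_iff)
  qed
qed

section \<open>Pre-geodesic level curves\<close>

text \<open>Parallelism is stated as a vanishing determinant, a continuous condition free of
  division. It leaves only tangential acceleration, which the passage to unit hyperbolic speed
  removes.\<close>

lemma pregeodesic_if_acceleration_parallel:
  assumes rc: "regular_curve I \<gamma>" and H2: "\<gamma> ` I \<subseteq> H2"
    and par: "\<And>t. t \<in> I \<Longrightarrow>
      velocity \<gamma> t $ 1 * covariant_acceleration H2_metric \<gamma> t $ 2 =
      velocity \<gamma> t $ 2 * covariant_acceleration H2_metric \<gamma> t $ 1"
  shows "pregeodesic H2_metric H2 I \<gamma>"
proof -
  have \<gamma>: "Ck_on 2 I \<gamma>" "open I" and I: "is_interval I" "I \<noteq> {}"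
    and nz: "\<And>t. t \<in> I \<Longrightarrow> velocity \<gamma> t \<noteq> 0"
    using rc by (auto simp: regular_curve_def)
  note D = Ck_on_2_curveD[OF \<gamma>]
  define v A y where "v = velocity \<gamma>" and "A = velocity (velocity \<gamma>)" and "y t = \<gamma> t $ 2" for t
  have y: "y t > 0" if "t \<in> I" for t using H2 that by (auto simp: y_def H2_def)
  define S where "S t = sqrt ((v t $ 1)\<^sup>2 + (v t $ 2)\<^sup>2)" for t
  have S: "S t > 0" "(S t)\<^sup>2 = (v t $ 1)\<^sup>2 + (v t $ 2)\<^sup>2" if "t \<in> I" for t
    using nz[OF that] by (auto simp: S_def v_def vec_eq_iff forall_2 sum_power2_gt_zero_iff)
  \<comment> \<open>\<open>w\<close> is the hyperbolic speed, so the reparametrization is by arc length.\<close>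
  define w where "w t = S t / y t" for t
  define w' where "w' t = (v t $ 1 * A t $ 1 + v t $ 2 * A t $ 2) / (S t * y t) - S t * v t $ 2 / (y t)\<^sup>2" for t
  have dy: "(y has_field_derivative v t $ 2) (at t)"
    and dv: "((\<lambda>t. v t $ k) has_field_derivative A t $ k) (at t)" if "t \<in> I" for t k
    unfolding y_def[abs_def] v_def A_def using D(1,2)[OF that] by (auto intro: DERIV_vec_nth)
  have dS: "(S has_field_derivative (v t $ 1 * A t $ 1 + v t $ 2 * A t $ 2) / S t) (at t)" if "t \<in> I" for t
  proof -
    have d: "((\<lambda>t. (v t $ 1)\<^sup>2 + (v t $ 2)\<^sup>2) has_field_derivative
        2 * (v t $ 1 * A t $ 1 + v t $ 2 * A t $ 2)) (at t)"
      by (auto intro!: derivative_eq_intros dv that simp: algebra_simps)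
    have pos: "(v t $ 1)\<^sup>2 + (v t $ 2)\<^sup>2 > 0" using S(1)[OF that] by (simp add: S_def)
    have half: "inverse r / 2 * (2 * z) = z / r" for r z :: real
      by (cases "r = 0") (simp_all add: field_simps)
    show ?thesis
      using DERIV_chain2[OF DERIV_real_sqrt[OF pos] d] unfolding S_def[abs_def] half .
  qed
  have dw: "(w has_field_derivative w' t) (at t)" if "t \<in> I" for t
    unfolding w_def[abs_def]
    by (rule DERIV_cong[OF DERIV_divide[OF dS[OF that] dy[OF that]]])
      (use S(1)[OF that] y[OF that] in \<open>auto simp: w'_def field_simps power2_eq_square\<close>)
  have w: "w t > 0" if "t \<in> I" for t using S(1) y that by (simp add: w_def)
  have cont: "continuous_on I y" "continuous_on I S" "continuous_on I (\<lambda>t. v t $ k)" for k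
    using dy dS dv by (meson DERIV_isCont continuous_at_imp_continuous_on)+
  have cA: "continuous_on I (\<lambda>t. A t $ k)" for k
    using D(3) unfolding A_def by (intro continuous_intros)
  have cw': "continuous_on I w'"
    unfolding w'_def[abs_def] using S(1) y
    by (intro continuous_intros cont cA) (auto simp: less_imp_neq[symmetric])
  obtain J \<phi> where J: "open J" "is_interval J" and \<phi>: "Ck_on 2 J \<phi>" "bij_betw \<phi> J I"
    and v\<phi>: "\<And>s. s \<in> J \<Longrightarrow> velocity \<phi> s = 1 / w (\<phi> s)"
      "\<And>s. s \<in> J \<Longrightarrow> velocity (velocity \<phi>) s = - w' (\<phi> s) / w (\<phi> s) ^ 3"
    using reparametrization_with_speed[OF \<gamma>(2) I(1) w dw cw'] by blast
  have im: "\<phi> ` J = I" using \<phi>(2) by (simp add: bij_betw_def)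
  note R = reparametrized_curve[OF \<gamma> \<phi>(1) J(1)]
  have zero: "covariant_acceleration H2_metric (\<gamma> \<circ> \<phi>) s = 0" if s: "s \<in> J" for s
  proof -
    define t where "t = \<phi> s"
    have t: "t \<in> I" using s im by (auto simp: t_def)
    define W where "W = covariant_acceleration H2_metric \<gamma> t"
    have W: "W $ 1 = A t $ 1 - 2 * v t $ 1 * v t $ 2 / y t" "W $ 2 = A t $ 2 + ((v t $ 1)\<^sup>2 - (v t $ 2)\<^sup>2) / y t"
      using y[OF t]
      by (simp_all add: W_def covariant_acceleration_def A_def v_def y_def christoffel_term_H2
          power2_eq_square algebra_simps)
    \<comment> \<open>Compatibility of the connection with the metric, in coordinates: the
      derivative of the hyperbolic speed is determined by the tangential part of the covariant
      acceleration.\<close>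
    have "v t $ 1 * A t $ 1 + v t $ 2 * A t $ 2 = v t $ 1 * W $ 1 + v t $ 2 * W $ 2 + v t $ 2 * (S t)\<^sup>2 / y t"
      unfolding S(2)[OF t] W using y[OF t] by (simp add: field_simps power2_eq_square)
    then have w't: "w' t = (v t $ 1 * W $ 1 + v t $ 2 * W $ 2) / (S t * y t)"
      unfolding w'_def using S(1)[OF t] y[OF t] by (simp add: field_simps power2_eq_square)
    have p: "v t $ 1 * W $ 2 = v t $ 2 * W $ 1" using par[OF t] by (simp add: W_def v_def)
    \<comment> \<open>Being parallel to the velocity, \<open>W\<close> equals its own orthogonal
      projection onto it.\<close>
    have k: "(S t)\<^sup>2 * W $ k = (v t $ 1 * W $ 1 + v t $ 2 * W $ 2) * v t $ k" for k
    proof -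
      have "(S t)\<^sup>2 * W $ 1 = (v t $ 1 * W $ 1 + v t $ 2 * W $ 2) * v t $ 1"
        "(S t)\<^sup>2 * W $ 2 = (v t $ 1 * W $ 1 + v t $ 2 * W $ 2) * v t $ 2"
        unfolding S(2)[OF t] using p by algebra+
      then show ?thesis using exhaust_2[of k] by auto
    qed
    have "w t * W $ k = w' t * v t $ k" for k
    proof -
      have "w t * W $ k = (S t)\<^sup>2 * W $ k / (S t * y t)"
        using S(1)[OF t] by (simp add: w_def power2_eq_square)
      then show ?thesis unfolding k w't by simp
    qed
    then have wW: "w t *\<^sub>R W = w' t *\<^sub>R v t" by (simp add: vec_eq_iff)
    \<comment> \<open>The relation between \<open>W\<close> and the velocity makes the two terms of
      the transformation rule, with factors 1/w^2 and -w'/w^3, cancel.\<close>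
    have "(1 / w t)\<^sup>2 *\<^sub>R W = (1 / w t ^ 3) *\<^sub>R w t *\<^sub>R W"
      using w[OF t] by (simp add: power2_eq_square power3_eq_cube)
    also have "\<dots> = (w' t / w t ^ 3) *\<^sub>R v t"
      unfolding wW by simp
    finally show ?thesis
      using R(2)[OF _ s, of H2_metric] im v\<phi>[OF s] by (simp add: W_def v_def flip: t_def)
  qed
  have "geodesic H2_metric H2 J (\<gamma> \<circ> \<phi>)"
    using J R(1) im H2 I(2) zero
    by (auto simp: geodesic_def covariant_acceleration_def image_comp[symmetric])
  moreover have "velocity \<phi> s \<noteq> 0" if "s \<in> J" for s
    using v\<phi>(1)[OF that] w im that by (metis divide_eq_0_iff image_eqI less_irrefl zero_neq_one)
  ultimately show ?thesis
    unfolding pregeodesic_def using rc J \<phi> by blast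
qed

text \<open>With zero level curvature, the nonzero Euclidean gradient is orthogonal to the velocity
  and to the covariant acceleration; in the plane these two are then parallel.\<close>

lemma level_curve_acceleration_parallel:
  fixes f :: "real ^ 2 \<Rightarrow> real"
  assumes f: "Ck_on 2 \<Omega> f" "open \<Omega>" "\<Omega> \<subseteq> H2" and lc: "level_curve \<Omega> f I \<gamma>" and t: "t \<in> I"
    and reg: "partial 1 f (\<gamma> t) \<noteq> 0 \<or> partial 2 f (\<gamma> t) \<noteq> 0"
    and flat: "level_curvature f (\<gamma> t) = 0"
  shows "velocity \<gamma> t $ 1 * covariant_acceleration H2_metric \<gamma> t $ 2 =
      velocity \<gamma> t $ 2 * covariant_acceleration H2_metric \<gamma> t $ 1"
proof -
  define a b where "a = partial 1 f (\<gamma> t)" and "b = partial 2 f (\<gamma> t)"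
  define v W where "v = velocity \<gamma> t" and "W = covariant_acceleration H2_metric \<gamma> t"
  have "a\<^sup>2 + b\<^sup>2 \<noteq> 0" using reg by (simp add: a_def b_def)
  then have "a * W $ 1 + b * W $ 2 = 0"
    using level_curve_acceleration[OF f lc t] flat reg by (auto simp: a_def b_def W_def)
  moreover have "a * v $ 1 + b * v $ 2 = 0"
    using level_curve_derivatives(1)[OF f(1,2) lc t] by (simp add: a_def b_def v_def)
  ultimately have "(a\<^sup>2 + b\<^sup>2) * (v $ 1 * W $ 2 - v $ 2 * W $ 1) = 0" by algebra
  then show ?thesis using \<open>a\<^sup>2 + b\<^sup>2 \<noteq> 0\<close> by (auto simp: v_def W_def)
qed

text \<open>The covariant acceleration is a multiple of the velocity, hence orthogonal to the
  gradient. The acceleration formula leaves the level curvature times a square, nonzero because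
  neither the gradient nor the velocity vanishes.\<close>

lemma level_curvature_zero_if_pregeodesic:
  fixes f :: "real ^ 2 \<Rightarrow> real"
  assumes f: "Ck_on 2 \<Omega> f" "open \<Omega>" "\<Omega> \<subseteq> H2" and lc: "level_curve \<Omega> f I \<gamma>" and t: "t \<in> I"
    and reg: "partial 1 f (\<gamma> t) \<noteq> 0 \<or> partial 2 f (\<gamma> t) \<noteq> 0"
    and pre: "pregeodesic H2_metric H2 I \<gamma>"
  shows "level_curvature f (\<gamma> t) = 0"
proof -
  define a b where "a = partial 1 f (\<gamma> t)" and "b = partial 2 f (\<gamma> t)"
  define v W where "v = velocity \<gamma> t" and "W = covariant_acceleration H2_metric \<gamma> t"
  obtain l where "W = l *\<^sub>R v"
    using pregeodesic_acceleration[OF pre t] unfolding v_def W_def by blast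
  then have "W $ 1 = l * v $ 1" "W $ 2 = l * v $ 2" by simp_all
  moreover have av: "a * v $ 1 + b * v $ 2 = 0"
    using level_curve_derivatives(1)[OF f(1,2) lc t] by (simp add: a_def b_def v_def)
  ultimately have "a * W $ 1 + b * W $ 2 = 0" by algebra
  then have "(a * v $ 2 - b * v $ 1)\<^sup>2 * level_curvature f (\<gamma> t) = 0"
    using level_curve_acceleration[OF f lc t] by (simp add: a_def b_def v_def W_def)
  moreover have "a * v $ 2 - b * v $ 1 \<noteq> 0"
  proof
    assume m: "a * v $ 2 - b * v $ 1 = 0"
    have "(a\<^sup>2 + b\<^sup>2) * v $ 1 = 0" "(a\<^sup>2 + b\<^sup>2) * v $ 2 = 0"
      using av m by algebra+
    moreover have "a\<^sup>2 + b\<^sup>2 \<noteq> 0" using reg by (simp add: a_def b_def)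
    ultimately have "v = 0" by (auto simp: vec_eq_iff forall_2)
    then show False using lc t by (simp add: v_def level_curve_def regular_curve_def)
  qed
  ultimately show ?thesis by simp
qed

text \<open>In a coordinate with nonzero velocity the difference quotient has a nonzero limit,
  whereas it would be 0 at a return to the point. This keeps a level curve from lingering at a
  critical point.\<close>

lemma regular_curve_eventually_leaves_point:
  assumes \<gamma>: "(\<gamma> has_vector_derivative v) (at t)" and "v \<noteq> 0"
  shows "\<forall>\<^sub>F s in at t. \<gamma> s \<noteq> (\<gamma> t :: real ^ 'n::finite)"
proof -
  obtain k where k: "v $ k \<noteq> 0" using \<open>v \<noteq> 0\<close> by (auto simp: vec_eq_iff)
  have "((\<lambda>s. (\<gamma> s $ k - \<gamma> t $ k) / (s - t)) \<longlongrightarrow> v $ k) (at t)"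
    using DERIV_vec_nth[OF \<gamma>, of k] by (simp add: has_field_derivative_iff)
  from tendsto_imp_eventually_ne[OF this k] show ?thesis
    by eventually_elim auto
qed

theorem proposition3p2:
  fixes \<Omega> :: "(real ^ 2) set" and f :: "real ^ 2 \<Rightarrow> real"
  assumes "open \<Omega>" and "connected \<Omega>" and "\<Omega> \<noteq> {}" and "\<Omega> \<subseteq> H2"
    and "Ck_on 2 \<Omega> f"
    and "\<not> f constant_on \<Omega>"
    and "minimal_surface H2xR_metric \<Omega> (graph_map f)"
  shows "(\<forall>I \<gamma>. level_curve \<Omega> f I \<gamma> \<longrightarrow> pregeodesic H2_metric H2 I \<gamma>)
    \<longleftrightarrow> (\<forall>p\<in>\<Omega>. flat_laplacian f p = 0)"
proof -
  note f = \<open>Ck_on 2 \<Omega> f\<close> \<open>open \<Omega>\<close>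
  note P = Ck_on_2_partials[OF f]
  have H2: "p $ 2 > 0" if "p \<in> \<Omega>" for p using \<open>\<Omega> \<subseteq> H2\<close> that by (auto simp: H2_def)
  have pde: "flat_laplacian f p + (p $ 2)\<^sup>2 * level_curvature f p = 0" if "p \<in> \<Omega>" for p
    unfolding level_curvature_def
    using minimal_graph_equation[OF f(2) that H2[OF that] P(1) P(2)[OF that] assms(7)] by blast
  show ?thesis
  proof (intro iffI ballI allI impI)
    fix p assume geo: "\<forall>I \<gamma>. level_curve \<Omega> f I \<gamma> \<longrightarrow> pregeodesic H2_metric H2 I \<gamma>" and p: "p \<in> \<Omega>"
    have "level_curvature f p = 0"
    proof (cases "partial 1 f p = 0 \<and> partial 2 f p = 0")
      case True
      then show ?thesis by (simp add: level_curvature_def)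
    next
      case False
      then obtain I \<gamma> where "level_curve \<Omega> f I \<gamma>" "0 \<in> I" "\<gamma> 0 = p"
        using level_curve_through_regular_point[OF f p] by blast
      then show ?thesis
        using level_curvature_zero_if_pregeodesic[OF f \<open>\<Omega> \<subseteq> H2\<close>] geo False by blast
    qed
    then show "flat_laplacian f p = 0" using pde[OF p] by simp
  next
    fix I \<gamma> assume harm: "\<forall>p\<in>\<Omega>. flat_laplacian f p = 0" and lc: "level_curve \<Omega> f I \<gamma>"
    have flat: "level_curvature f p = 0" if "p \<in> \<Omega>" for p
      using pde[OF that] harm H2[OF that] that by simp
    have rc: "regular_curve I \<gamma>" and in_\<Omega>: "\<And>t. t \<in> I \<Longrightarrow> \<gamma> t \<in> \<Omega>"
      using lc by (auto simp: level_curve_def)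
    then have \<gamma>: "Ck_on 2 I \<gamma>" "open I" and nz: "\<And>t. t \<in> I \<Longrightarrow> velocity \<gamma> t \<noteq> 0"
      by (auto simp: regular_curve_def)
    note D = Ck_on_2_curveD[OF \<gamma>]
    \<comment> \<open>The determinant of velocity and covariant acceleration; the curve is a
      pre-geodesic once it vanishes throughout \<open>I\<close>.\<close>
    define x where "x t = velocity \<gamma> t $ 1 * covariant_acceleration H2_metric \<gamma> t $ 2 -
      velocity \<gamma> t $ 2 * covariant_acceleration H2_metric \<gamma> t $ 1" for t
    have cont: "continuous_on I \<gamma>" "continuous_on I (velocity \<gamma>)"
      using D(1,2) by (meson continuous_at_imp_continuous_on has_vector_derivative_continuous)+
    \<comment> \<open>Written out through velocity and acceleration, the determinant is visibly
      continuous.\<close>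
    have x: "x t = velocity \<gamma> t $ 1 * (velocity (velocity \<gamma>) t $ 2
          + (velocity \<gamma> t $ 1 * velocity \<gamma> t $ 1 - velocity \<gamma> t $ 2 * velocity \<gamma> t $ 2) / \<gamma> t $ 2)
      - velocity \<gamma> t $ 2 * (velocity (velocity \<gamma>) t $ 1
          + - (velocity \<gamma> t $ 1 * velocity \<gamma> t $ 2 + velocity \<gamma> t $ 2 * velocity \<gamma> t $ 1) / \<gamma> t $ 2)"
      if "t \<in> I" for t
      using H2[OF in_\<Omega>[OF that]]
      by (simp add: x_def covariant_acceleration_def christoffel_term_H2)
    have "\<gamma> t $ 2 \<noteq> 0" if "t \<in> I" for t using H2[OF in_\<Omega>[OF that]] by simp
    then have cx: "continuous_on I x"
      using cont D(3)
      by (subst continuous_on_cong[OF refl x]) (auto intro!: continuous_intros)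
    have x_reg: "x t = 0" if "t \<in> I" "partial 1 f (\<gamma> t) \<noteq> 0 \<or> partial 2 f (\<gamma> t) \<noteq> 0" for t
      using level_curve_acceleration_parallel[OF f \<open>\<Omega> \<subseteq> H2\<close> lc that flat[OF in_\<Omega>[OF that(1)]]]
      by (simp add: x_def)
    have "x t = 0" if t: "t \<in> I" for t
    proof (cases "partial 1 f (\<gamma> t) = 0 \<and> partial 2 f (\<gamma> t) = 0")
      case True
      then obtain r where r: "r > 0" "\<And>q. q \<in> ball (\<gamma> t) r - {\<gamma> t} \<Longrightarrow>
          q \<in> \<Omega> \<and> (partial 1 f q \<noteq> 0 \<or> partial 2 f q \<noteq> 0)"
        using harmonic_critical_point_isolated[OF f \<open>connected \<Omega>\<close> assms(6) _ in_\<Omega>[OF t]] harm by metis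
      have "\<forall>\<^sub>F s in at t. s \<in> I"
        using \<gamma>(2) t by (rule eventually_at_in_open')
      moreover have "isCont \<gamma> t"
        using D(1)[OF t] has_vector_derivative_continuous by blast
      then have "\<forall>\<^sub>F s in at t. \<gamma> s \<in> ball (\<gamma> t) r"
        using r(1) by (intro topological_tendstoD[of \<gamma> "\<gamma> t"]) (auto simp: isCont_def)
      moreover have "\<forall>\<^sub>F s in at t. \<gamma> s \<noteq> \<gamma> t"
        using D(1)[OF t] nz[OF t] by (rule regular_curve_eventually_leaves_point)
      \<comment> \<open>Near \<open>t\<close> but away from it the curve meets only regular points,
        where \<open>x\<close> vanishes; continuity then gives the value at
        \<open>t\<close>.\<close>
      ultimately have "\<forall>\<^sub>F s in at t. x s = 0"
        by eventually_elim (use r(2) x_reg in auto)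
      then have "(x \<longlongrightarrow> 0) (at t)" by (rule tendsto_eventually)
      moreover have "(x \<longlongrightarrow> x t) (at t)"
        using cx \<gamma>(2) t by (simp add: continuous_on_eq_continuous_at isCont_def)
      ultimately show ?thesis using tendsto_unique[OF trivial_limit_at] by blast
    qed (use x_reg t in blast)
    then show "pregeodesic H2_metric H2 I \<gamma>"
      using rc in_\<Omega> \<open>\<Omega> \<subseteq> H2\<close>
      by (intro pregeodesic_if_acceleration_parallel) (auto simp: x_def)
  qed
qed

end
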